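(* Let $\mathfrak q$ be a Leibniz algebra having a free presentation $0\to\mathfrak s\to\mathfrak f\xrightarrow{\tau}\mathfrak q\to0$ (with $\mathfrak f$ a free Leibniz algebra) satisfying $\mathfrak s\subseteq[\mathfrak f,\mathfrak f]_{\mathsf{Lie}}$. Then all $\mathsf{Lie}$-stem covers of $\mathfrak q$ are mutually $\mathsf{Lie}$-isoclinic.
   Context: $\mathbb K$ is a field with $\frac12\in\mathbb K$. A Leibniz algebra is a $\mathbb K$-vector space $\mathfrak q$ with a bilinear bracket satisfying $[x,[y,z]]=[[x,y],z]-[[x,z],y]$; homomorphisms are linear maps preserving the bracket. For two-sided ideals $\mathfrak m,\mathfrak n$ of $\mathfrak q$, $[\mathfrak m,\mathfrak n]_{\mathsf{Lie}}$ is the two-sided ideal of $\mathfrak q$ generated by $\{[m,n]+[n,m] : m\in\mathfrak m,n\in\mathfrak n\}$, and $Z_{\mathsf{Lie}}(\mathfrak q)=\{z\in\mathfrak q : [q,z]+[z,q]=0\ \forall q\in\mathfrak q\}$ (a two-sided ideal). $\mathfrak q_{\mathsf{Lie}}$ is the quotient of $\mathfrak q$ by the subspace (a two-sided ideal) spanned by all $[x,x]$, $x\in\mathfrak q$. An extension (short exact sequence of Leibniz algebras) $(g):0\to\mathfrak n\xrightarrow{\chi}\mathfrak g\xrightarrow{\pi}\mathfrak q\to0$ (an extension of $\mathfrak q$) is $\mathsf{Lie}$-central if $\chi(\mathfrak n)\subseteq Z_{\mathsf{Lie}}(\mathfrak g)$, equivalently $[\chi(\mathfrak n),\mathfrak g]_{\mathsf{Lie}}=0$.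 Its $\mathsf{Lie}$-commutator map is the well-defined map $C:\mathfrak q\times\mathfrak q\to[\mathfrak g,\mathfrak g]_{\mathsf{Lie}}$, $C(q_1,q_2)=[x_1,x_2]+[x_2,x_1]$ where $\pi(x_j)=q_j$. $\mathsf{Lie}$-central extensions $(g_1),(g_2)$ (with commutator maps $C_1,C_2$) are $\mathsf{Lie}$-isoclinic if there are isomorphisms $\eta:\mathfrak q_1\to\mathfrak q_2$, $\xi:[\mathfrak g_1,\mathfrak g_1]_{\mathsf{Lie}}\to[\mathfrak g_2,\mathfrak g_2]_{\mathsf{Lie}}$ with $\xi\circ C_1=C_2\circ(\eta\times\eta)$. For a free presentation $0\to\mathfrak r\to\mathfrak f\to\mathfrak q\to0$, $\mathrm{HL}_2^{\mathsf{Lie}}(\mathfrak q)=\dfrac{\mathfrak r\cap[\mathfrak f,\mathfrak f]_{\mathsf{Lie}}}{[\mathfrak r,\mathfrak f]_{\mathsf{Lie}}}$ (independent of the presentation up to canonical isomorphism); a homomorphism of Leibniz algebras induces a map on $\mathrm{HL}_2^{\mathsf{Lie}}$ via any lift to the free Leibniz algebras of the presentations. A $\mathsf{Lie}$-central extension $0\to\mathfrak n\to\mathfrak g\xrightarrow{\pi}\mathfrak q\to0$ is a $\mathsf{Lie}$-stem extension if $\pi$ induces an isomorphism $\mathfrak g_{\mathsf{Lie}}\cong\mathfrak q_{\mathsf{Lie}}$; it is a $\mathsf{Lie}$-stem cover if moreover the induced map $\mathrm{HL}_2^{\mathsf{Lie}}(\mathfrak g)\to\mathrm{HL}_2^{\mathsf{Lie}}(\mathfrak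 q)$ is zero. *)

theory Defs
  imports "HOL-Algebra.Module" "HOL-Algebra.AbelCoset"
begin

section \<open>Leibniz algebras\<close>

text \<open>The fields \<open>mult\<close> and \<open>one\<close> inherited from the record \<open>module\<close> carry no meaning here:
  no definition below looks at them.\<close>

record ('k, 'a) leibniz = "('k, 'a) module" +
  bracket :: "'a \<Rightarrow> 'a \<Rightarrow> 'a"  (\<open>\<lblot>_,/ _\<rblot>\<index>\<close>)

locale leibniz_algebra = K: field K + G: module K G
  for K :: "('k, 'm) ring_scheme" (structure) and G :: "('k, 'a, 'n) leibniz_scheme" (structure) +
  assumes bracket_closed [simp, intro]:
      "\<lbrakk>x \<in> carrier G; y \<in> carrier G\<rbrakk> \<Longrightarrow> \<lblot>x, y\<rblot>\<^bsub>G\<^esub> \<in> carrier G"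
    and bracket_add_left:
      "\<lbrakk>x \<in> carrier G; y \<in> carrier G; z \<in> carrier G\<rbrakk> \<Longrightarrow>
        \<lblot>x \<oplus>\<^bsub>G\<^esub> y, z\<rblot>\<^bsub>G\<^esub> = \<lblot>x, z\<rblot>\<^bsub>G\<^esub> \<oplus>\<^bsub>G\<^esub> \<lblot>y, z\<rblot>\<^bsub>G\<^esub>"
    and bracket_add_right:
      "\<lbrakk>x \<in> carrier G; y \<in> carrier G; z \<in> carrier G\<rbrakk> \<Longrightarrow>
        \<lblot>x, y \<oplus>\<^bsub>G\<^esub> z\<rblot>\<^bsub>G\<^esub> = \<lblot>x, y\<rblot>\<^bsub>G\<^esub> \<oplus>\<^bsub>G\<^esub> \<lblot>x, z\<rblot>\<^bsub>G\<^esub>"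
    and bracket_smult_left:
      "\<lbrakk>a \<in> carrier K; x \<in> carrier G; y \<in> carrier G\<rbrakk> \<Longrightarrow>
        \<lblot>a \<odot>\<^bsub>G\<^esub> x, y\<rblot>\<^bsub>G\<^esub> = a \<odot>\<^bsub>G\<^esub> \<lblot>x, y\<rblot>\<^bsub>G\<^esub>"
    and bracket_smult_right:
      "\<lbrakk>a \<in> carrier K; x \<in> carrier G; y \<in> carrier G\<rbrakk> \<Longrightarrow>
        \<lblot>x, a \<odot>\<^bsub>G\<^esub> y\<rblot>\<^bsub>G\<^esub> = a \<odot>\<^bsub>G\<^esub> \<lblot>x, y\<rblot>\<^bsub>G\<^esub>"
    and leibniz_identity:
      "\<lbrakk>x \<in> carrier G; y \<in> carrier G; z \<in> carrier G\<rbrakk> \<Longrightarrow>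
        \<lblot>x, \<lblot>y, z\<rblot>\<^bsub>G\<^esub>\<rblot>\<^bsub>G\<^esub> = \<lblot>\<lblot>x, y\<rblot>\<^bsub>G\<^esub>, z\<rblot>\<^bsub>G\<^esub> \<ominus>\<^bsub>G\<^esub> \<lblot>\<lblot>x, z\<rblot>\<^bsub>G\<^esub>, y\<rblot>\<^bsub>G\<^esub>"

definition leibniz_hom ::
  "('k, 'm) ring_scheme \<Rightarrow> ('k, 'a, 'n) leibniz_scheme \<Rightarrow> ('k, 'b, 'o) leibniz_scheme \<Rightarrow> ('a \<Rightarrow> 'b) set"
  where "leibniz_hom K G H = {h \<in> carrier G \<rightarrow> carrier H.
    (\<forall>x\<in>carrier G. \<forall>y\<in>carrier G. h (x \<oplus>\<^bsub>G\<^esub> y) = h x \<oplus>\<^bsub>H\<^esub> h y) \<and>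
    (\<forall>a\<in>carrier K. \<forall>x\<in>carrier G. h (a \<odot>\<^bsub>G\<^esub> x) = a \<odot>\<^bsub>H\<^esub> h x) \<and>
    (\<forall>x\<in>carrier G. \<forall>y\<in>carrier G. h \<lblot>x, y\<rblot>\<^bsub>G\<^esub> = \<lblot>h x, h y\<rblot>\<^bsub>H\<^esub>)}"

definition leibniz_iso ::
  "('k, 'm) ring_scheme \<Rightarrow> ('k, 'a, 'n) leibniz_scheme \<Rightarrow> ('k, 'b, 'o) leibniz_scheme \<Rightarrow> ('a \<Rightarrow> 'b) set"
  where "leibniz_iso K G H = {h \<in> leibniz_hom K G H. bij_betw h (carrier G) (carrier H)}"


section \<open>Ideals and quotients\<close>

definition leibniz_ideal ::
  "('k, 'm) ring_scheme \<Rightarrow> ('k, 'a, 'n) leibniz_scheme \<Rightarrow> 'a set \<Rightarrow> bool"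
  where "leibniz_ideal K G I \<longleftrightarrow> submodule I K G \<and>
    (\<forall>x\<in>I. \<forall>y\<in>carrier G. \<lblot>x, y\<rblot>\<^bsub>G\<^esub> \<in> I \<and> \<lblot>y, x\<rblot>\<^bsub>G\<^esub> \<in> I)"

definition leibniz_ideal_gen ::
  "('k, 'm) ring_scheme \<Rightarrow> ('k, 'a, 'n) leibniz_scheme \<Rightarrow> 'a set \<Rightarrow> 'a set"
  where "leibniz_ideal_gen K G S = \<Inter>{I. leibniz_ideal K G I \<and> S \<subseteq> I}"

definition lie_comm ::
  "('k, 'm) ring_scheme \<Rightarrow> ('k, 'a, 'n) leibniz_scheme \<Rightarrow> 'a set \<Rightarrow> 'a set \<Rightarrow> 'a set"
  where "lie_comm K G M N =
    leibniz_ideal_gen K G {\<lblot>m, n\<rblot>\<^bsub>G\<^esub> \<oplus>\<^bsub>G\<^esub> \<lblot>n, m\<rblot>\<^bsub>G\<^esub> | m n. m \<in> M \<and> n \<in> N}"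

definition lie_center :: "('k, 'a, 'n) leibniz_scheme \<Rightarrow> 'a set"
  where "lie_center G =
    {z \<in> carrier G. \<forall>q\<in>carrier G. \<lblot>q, z\<rblot>\<^bsub>G\<^esub> \<oplus>\<^bsub>G\<^esub> \<lblot>z, q\<rblot>\<^bsub>G\<^esub> = \<zero>\<^bsub>G\<^esub>}"

text \<open>The quotient by a two-sided ideal. On cosets, the unions collapse to a single coset.\<close>

definition leibniz_quot :: "('k, 'a, 'n) leibniz_scheme \<Rightarrow> 'a set \<Rightarrow> ('k, 'a set) leibniz"
  where "leibniz_quot G I = \<lparr>carrier = a_rcosets\<^bsub>G\<^esub> I, mult = undefined, one = undefined,
    zero = I, add = set_add G,
    smult = (\<lambda>a A. \<Union>x\<in>A. I +>\<^bsub>G\<^esub> (a \<odot>\<^bsub>G\<^esub> x)),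
    bracket = (\<lambda>A B. \<Union>x\<in>A. \<Union>y\<in>B. I +>\<^bsub>G\<^esub> \<lblot>x, y\<rblot>\<^bsub>G\<^esub>)\<rparr>"

text \<open>The map into \<open>H / J\<close> induced by \<open>f\<close> on cosets in the domain of \<open>f\<close>, sending the coset
  of \<open>x\<close> to the coset of \<open>f x\<close>.\<close>

definition quot_map ::
  "('k, 'b, 'o) leibniz_scheme \<Rightarrow> 'b set \<Rightarrow> ('a \<Rightarrow> 'b) \<Rightarrow> 'a set \<Rightarrow> 'b set"
  where "quot_map H J f A = (\<Union>x\<in>A. J +>\<^bsub>H\<^esub> f x)"

definition square_span ::
  "('k, 'm) ring_scheme \<Rightarrow> ('k, 'a, 'n) leibniz_scheme \<Rightarrow> 'a set"
  where "square_span K G = \<Inter>{I. submodule I K G \<and> (\<forall>x\<in>carrier G. \<lblot>x, x\<rblot>\<^bsub>G\<^esub> \<in> I)}"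

definition liezation ::
  "('k, 'm) ring_scheme \<Rightarrow> ('k, 'a, 'n) leibniz_scheme \<Rightarrow> ('k, 'a set) leibniz"
  where "liezation K G = leibniz_quot G (square_span K G)"


section \<open>Extensions and Lie-isoclinism\<close>

definition leibniz_extension ::
  "('k, 'm) ring_scheme \<Rightarrow> ('k, 'n) leibniz \<Rightarrow> ('n \<Rightarrow> 'g) \<Rightarrow>
    ('k, 'g) leibniz \<Rightarrow> ('g \<Rightarrow> 'q) \<Rightarrow> ('k, 'q) leibniz \<Rightarrow> bool"
  where "leibniz_extension K N \<chi> G \<pi> Q \<longleftrightarrow>
    leibniz_algebra K N \<and> leibniz_algebra K G \<and> leibniz_algebra K Q \<and>
    \<chi> \<in> leibniz_hom K N G \<and> inj_on \<chi> (carrier N) \<and>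
    \<pi> \<in> leibniz_hom K G Q \<and> \<pi> ` carrier G = carrier Q \<and>
    \<chi> ` carrier N = a_kernel G Q \<pi>"

definition lie_central_extension ::
  "('k, 'm) ring_scheme \<Rightarrow> ('k, 'n) leibniz \<Rightarrow> ('n \<Rightarrow> 'g) \<Rightarrow>
    ('k, 'g) leibniz \<Rightarrow> ('g \<Rightarrow> 'q) \<Rightarrow> ('k, 'q) leibniz \<Rightarrow> bool"
  where "lie_central_extension K N \<chi> G \<pi> Q \<longleftrightarrow>
    leibniz_extension K N \<chi> G \<pi> Q \<and> \<chi> ` carrier N \<subseteq> lie_center G"

text \<open>The preimages are picked by \<open>inv_into\<close>; for a Lie-central extension the value does not
  depend on this choice.\<close>

definition lie_comm_map :: "('k, 'g) leibniz \<Rightarrow> ('g \<Rightarrow> 'q) \<Rightarrow> 'q \<Rightarrow> 'q \<Rightarrow> 'g"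
  where "lie_comm_map G \<pi> q1 q2 =
    (let x1 = inv_into (carrier G) \<pi> q1; x2 = inv_into (carrier G) \<pi> q2
     in \<lblot>x1, x2\<rblot>\<^bsub>G\<^esub> \<oplus>\<^bsub>G\<^esub> \<lblot>x2, x1\<rblot>\<^bsub>G\<^esub>)"

definition lie_isoclinic ::
  "('k, 'm) ring_scheme \<Rightarrow> ('k, 'g1) leibniz \<Rightarrow> ('g1 \<Rightarrow> 'q1) \<Rightarrow> ('k, 'q1) leibniz \<Rightarrow>
    ('k, 'g2) leibniz \<Rightarrow> ('g2 \<Rightarrow> 'q2) \<Rightarrow> ('k, 'q2) leibniz \<Rightarrow> bool"
  where "lie_isoclinic K G1 \<pi>1 Q1 G2 \<pi>2 Q2 \<longleftrightarrow>
    (\<exists>\<eta> \<in> leibniz_iso K Q1 Q2.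
     \<exists>\<xi> \<in> leibniz_iso K (G1\<lparr>carrier := lie_comm K G1 (carrier G1) (carrier G1)\<rparr>)
                       (G2\<lparr>carrier := lie_comm K G2 (carrier G2) (carrier G2)\<rparr>).
     \<forall>x\<in>carrier Q1. \<forall>y\<in>carrier Q1.
       \<xi> (lie_comm_map G1 \<pi>1 x y) = lie_comm_map G2 \<pi>2 (\<eta> x) (\<eta> y))"


section \<open>Free Leibniz algebras\<close>

text \<open>The free Leibniz algebra on a set \<open>X\<close>, in the model of Loday and Pirashvili: the reduced
  tensor module over the vector space with basis \<open>X\<close>, i.e. the finitely supported functions on
  nonempty words over \<open>X\<close>, where the bracket with a letter on the right is \<open>[p, x] = p \<otimes> x\<close>.
  The Leibniz identity then forces \<open>[p, x\<^sub>1 \<dots> x\<^sub>n] = p \<otimes> [[x\<^sub>1, x\<^sub>2], \<dots>, x\<^sub>n]\<close>, the right-hand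
  commutator being the one of the tensor algebra.\<close>

definition append_letter ::
  "('k, 'm) ring_scheme \<Rightarrow> 'x \<Rightarrow> ('x list \<Rightarrow> 'k) \<Rightarrow> 'x list \<Rightarrow> 'k"
  where "append_letter K x p w =
    (if w \<noteq> [] \<and> last w = x then p (butlast w) else \<zero>\<^bsub>K\<^esub>)"

text \<open>\<open>word_act K v p\<close> is the bracket of \<open>p\<close> with the word \<open>rev v\<close>; words are read backwards so
  that the recursion \<open>[p, w x] = [p, w] \<otimes> x - [p \<otimes> x, w]\<close> is structural. The equation for the
  empty word is a dummy.\<close>

fun word_act ::
  "('k, 'm) ring_scheme \<Rightarrow> 'x list \<Rightarrow> ('x list \<Rightarrow> 'k) \<Rightarrow> 'x list \<Rightarrow> 'k"
  where
    "word_act K [] p = p"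
  | "word_act K [x] p = append_letter K x p"
  | "word_act K (x # y # v) p =
      (\<lambda>w. append_letter K x (word_act K (y # v) p) w \<ominus>\<^bsub>K\<^esub> word_act K (y # v) (append_letter K x p) w)"

definition word_supp :: "('k, 'm) ring_scheme \<Rightarrow> ('x list \<Rightarrow> 'k) \<Rightarrow> 'x list set"
  where "word_supp K p = {w. p w \<noteq> \<zero>\<^bsub>K\<^esub>}"

definition free_leibniz ::
  "('k, 'm) ring_scheme \<Rightarrow> 'x set \<Rightarrow> ('k, 'x list \<Rightarrow> 'k) leibniz"
  where "free_leibniz K X = \<lparr>
    carrier = {p. range p \<subseteq> carrier K \<and> finite (word_supp K p) \<and> word_supp K p \<subseteq> lists X - {[]}},
    mult = undefined, one = undefined,
    zero = (\<lambda>w. \<zero>\<^bsub>K\<^esub>),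
    add = (\<lambda>p q w. p w \<oplus>\<^bsub>K\<^esub> q w),
    smult = (\<lambda>a p w. a \<otimes>\<^bsub>K\<^esub> p w),
    bracket = (\<lambda>p q w. \<Oplus>\<^bsub>K\<^esub>v\<in>word_supp K q. q v \<otimes>\<^bsub>K\<^esub> word_act K (rev v) p w)\<rparr>"

definition free_word :: "('k, 'm) ring_scheme \<Rightarrow> 'x list \<Rightarrow> 'x list \<Rightarrow> 'k"
  where "free_word K v w = (if w = v then \<one>\<^bsub>K\<^esub> else \<zero>\<^bsub>K\<^esub>)"

definition free_letter :: "('k, 'm) ring_scheme \<Rightarrow> 'x \<Rightarrow> 'x list \<Rightarrow> 'k"
  where "free_letter K x = free_word K [x]"

fun left_normed :: "('k, 'a, 'n) leibniz_scheme \<Rightarrow> 'a list \<Rightarrow> 'a"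
  where
    "left_normed G [] = \<zero>\<^bsub>G\<^esub>"
  | "left_normed G (x # xs) = foldl (bracket G) x xs"

text \<open>The homomorphic extension of a map \<open>f\<close> from the generators to \<open>G\<close>.\<close>

definition free_lift ::
  "('k, 'm) ring_scheme \<Rightarrow> ('k, 'a, 'n) leibniz_scheme \<Rightarrow> ('x \<Rightarrow> 'a) \<Rightarrow> ('x list \<Rightarrow> 'k) \<Rightarrow> 'a"
  where "free_lift K G f p =
    (\<Oplus>\<^bsub>G\<^esub>w\<in>word_supp K p. p w \<odot>\<^bsub>G\<^esub> left_normed G (map f w))"

text \<open>A generating set of a free algebra embeds into it, so it suffices to consider generating
  sets \<open>X\<close> consisting of elements of the type of \<open>F\<close>.\<close>

definition is_free_leibniz ::
  "('k, 'm) ring_scheme \<Rightarrow> ('k, 'a) leibniz \<Rightarrow> bool"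
  where "is_free_leibniz K F \<longleftrightarrow> leibniz_algebra K F \<and>
    (\<exists>(X :: 'a set) \<phi>. \<phi> \<in> leibniz_iso K (free_leibniz K X) F)"

definition free_presentation ::
  "('k, 'm) ring_scheme \<Rightarrow> ('k, 's) leibniz \<Rightarrow> ('s \<Rightarrow> 'f) \<Rightarrow>
    ('k, 'f) leibniz \<Rightarrow> ('f \<Rightarrow> 'q) \<Rightarrow> ('k, 'q) leibniz \<Rightarrow> bool"
  where "free_presentation K S \<sigma> F \<tau> Q \<longleftrightarrow>
    leibniz_extension K S \<sigma> F \<tau> Q \<and> is_free_leibniz K F"

text \<open>The rest of this section shows that \<open>free_leibniz K X\<close> is a Leibniz algebra with the
  universal property of the free one: \<open>free_leibniz_algebra\<close>, \<open>free_lift_hom\<close> and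
  \<open>free_hom_unique\<close>.\<close>

lemma (in abelian_group) minus_cancel_aux:
  assumes [simp]: "a \<in> carrier G" "b \<in> carrier G" "c \<in> carrier G" "d \<in> carrier G"
    "e \<in> carrier G" "f \<in> carrier G"
  shows "(a \<ominus> b \<ominus> (c \<ominus> d)) \<ominus> ((e \<ominus> c) \<ominus> (b \<ominus> f)) = (a \<ominus> e) \<ominus> (f \<ominus> d)"
proof -
  have "(a \<ominus> b \<ominus> (c \<ominus> d)) \<ominus> ((e \<ominus> c) \<ominus> (b \<ominus> f)) =
    ((a \<ominus> e) \<ominus> (f \<ominus> d)) \<oplus> (b \<oplus> \<ominus> b) \<oplus> (c \<oplus> \<ominus> c)"
    by (simp add: minus_eq minus_add a_ac del: r_neg)
  then show ?thesis by (simp add: r_neg)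
qed

context field begin

abbreviation (input) Fr where "Fr X \<equiv> free_leibniz R X"

lemma free_carrier_iff:
  "p \<in> carrier (Fr X) \<longleftrightarrow>
    (\<forall>w. p w \<in> carrier R) \<and> finite (word_supp R p) \<and> (\<forall>w. p w \<noteq> \<zero> \<longrightarrow> w \<noteq> [] \<and> set w \<subseteq> X)"
  by (auto simp: free_leibniz_def word_supp_def)

lemma free_simps:
  "\<zero>\<^bsub>Fr X\<^esub> = (\<lambda>w. \<zero>)"
  "p \<oplus>\<^bsub>Fr X\<^esub> q = (\<lambda>w. p w \<oplus> q w)"
  "a \<odot>\<^bsub>Fr X\<^esub> p = (\<lambda>w. a \<otimes> p w)"
  "\<lblot>p, q\<rblot>\<^bsub>Fr X\<^esub> = (\<lambda>w. \<Oplus>v\<in>word_supp R q. q v \<otimes> word_act R (rev v) p w)"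
  by (simp_all add: free_leibniz_def)

lemma free_closed:
  "(\<lambda>w. \<zero>) \<in> carrier (Fr X)"
  "p \<in> carrier (Fr X) \<Longrightarrow> q \<in> carrier (Fr X) \<Longrightarrow> (\<lambda>w. p w \<oplus> q w) \<in> carrier (Fr X)"
  "p \<in> carrier (Fr X) \<Longrightarrow> q \<in> carrier (Fr X) \<Longrightarrow> (\<lambda>w. p w \<ominus> q w) \<in> carrier (Fr X)"
  "a \<in> carrier R \<Longrightarrow> p \<in> carrier (Fr X) \<Longrightarrow> (\<lambda>w. a \<otimes> p w) \<in> carrier (Fr X)"
proof -
  show "(\<lambda>w. \<zero>) \<in> carrier (Fr X)" by (simp add: free_carrier_iff word_supp_def)
  { assume p: "p \<in> carrier (Fr X)" and q: "q \<in> carrier (Fr X)"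
    have "word_supp R (\<lambda>w. p w \<oplus> q w) \<subseteq> word_supp R p \<union> word_supp R q"
      by (auto simp: word_supp_def)
    then have "finite (word_supp R (\<lambda>w. p w \<oplus> q w))"
      using p q by (meson finite_Un finite_subset free_carrier_iff)
    with p q show "(\<lambda>w. p w \<oplus> q w) \<in> carrier (Fr X)"
      unfolding free_carrier_iff by (metis a_closed l_zero zero_closed)
    have "word_supp R (\<lambda>w. p w \<ominus> q w) \<subseteq> word_supp R p \<union> word_supp R q"
      by (auto simp: word_supp_def a_minus_def)
    then have "finite (word_supp R (\<lambda>w. p w \<ominus> q w))"
      using p q by (meson finite_Un finite_subset free_carrier_iff)
    moreover have "p w \<noteq> \<zero> \<or> q w \<noteq> \<zero>" if "p w \<ominus> q w \<noteq> \<zero>" for w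
      using that by (auto simp: a_minus_def)
    ultimately show "(\<lambda>w. p w \<ominus> q w) \<in> carrier (Fr X)"
      using p q unfolding free_carrier_iff by (metis minus_closed) }
  { assume a: "a \<in> carrier R" and p: "p \<in> carrier (Fr X)"
    have "word_supp R (\<lambda>w. a \<otimes> p w) \<subseteq> word_supp R p"
      using a by (auto simp: word_supp_def)
    then have "finite (word_supp R (\<lambda>w. a \<otimes> p w))"
      using p by (meson finite_subset free_carrier_iff)
    with a p show "(\<lambda>w. a \<otimes> p w) \<in> carrier (Fr X)"
      unfolding free_carrier_iff by (metis m_closed r_null) }
qed

lemma free_module: "module R (Fr X)"
proof (intro moduleI abelian_groupI)
  show "cring R" by (rule is_cring)
  fix p assume "p \<in> carrier (Fr X)"
  then show "\<exists>q\<in>carrier (Fr X). q \<oplus>\<^bsub>Fr X\<^esub> p = \<zero>\<^bsub>Fr X\<^esub>"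
    using free_closed(3)[OF free_closed(1), of p X]
    by (intro bexI[where x = "\<lambda>w. \<zero> \<ominus> p w"])
       (auto simp: free_simps free_carrier_iff a_minus_def fun_eq_iff l_neg)
qed (auto simp: free_simps free_closed, auto simp: free_carrier_iff a_ac m_ac l_distr r_distr)

lemma free_minus:
  assumes "p \<in> carrier (Fr X)" "q \<in> carrier (Fr X)"
  shows "p \<ominus>\<^bsub>Fr X\<^esub> q = (\<lambda>w. p w \<ominus> q w)"
proof -
  interpret F: module R "Fr X" by (rule free_module)
  have c: "(\<lambda>w. p w \<ominus> q w) \<in> carrier (Fr X)" using assms by (rule free_closed)
  have "p = (\<lambda>w. p w \<ominus> q w) \<oplus>\<^bsub>Fr X\<^esub> q"
    using assms by (auto simp: free_simps free_carrier_iff fun_eq_iff a_minus_def a_assoc l_neg)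
  then have "p \<ominus>\<^bsub>Fr X\<^esub> q = ((\<lambda>w. p w \<ominus> q w) \<oplus>\<^bsub>Fr X\<^esub> q) \<ominus>\<^bsub>Fr X\<^esub> q"
    by simp
  also have "\<dots> = (\<lambda>w. p w \<ominus> q w)"
    using assms c by (simp add: F.minus_eq F.M.a_assoc F.M.r_neg)
  finally show ?thesis .
qed

lemma free_word_closed: "v \<noteq> [] \<Longrightarrow> set v \<subseteq> X \<Longrightarrow> free_word R v \<in> carrier (Fr X)"
  by (auto simp: free_carrier_iff free_word_def word_supp_def split: if_splits)

lemma word_supp_free_word: "word_supp R (free_word R v) = {v}"
  by (auto simp: word_supp_def free_word_def)

lemma free_induct [consumes 1, case_names zero word add smult]:
  assumes p: "p \<in> carrier (Fr X)"
    and zero: "P \<zero>\<^bsub>Fr X\<^esub>"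
    and word: "\<And>v. v \<noteq> [] \<Longrightarrow> set v \<subseteq> X \<Longrightarrow> P (free_word R v)"
    and add: "\<And>p q. p \<in> carrier (Fr X) \<Longrightarrow> q \<in> carrier (Fr X) \<Longrightarrow> P p \<Longrightarrow> P q \<Longrightarrow> P (p \<oplus>\<^bsub>Fr X\<^esub> q)"
    and smult: "\<And>a p. a \<in> carrier R \<Longrightarrow> p \<in> carrier (Fr X) \<Longrightarrow> P p \<Longrightarrow> P (a \<odot>\<^bsub>Fr X\<^esub> p)"
  shows "P p"
proof -
  have "finite (word_supp R p)" using p by (simp add: free_carrier_iff)
  then show ?thesis using p
  proof (induction "word_supp R p" arbitrary: p rule: finite_induct)
    case empty
    then have "p = \<zero>\<^bsub>Fr X\<^esub>" by (auto simp: word_supp_def free_simps)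
    with zero show ?case by simp
  next
    case (insert v S)
    define q where "q = p(v := \<zero>)"
    have S: "S = word_supp R q"
      using insert.hyps(2,4) by (auto simp: word_supp_def q_def)
    have q: "q \<in> carrier (Fr X)"
      using insert.prems S insert.hyps(1) by (auto simp: free_carrier_iff q_def)
    have v: "v \<noteq> []" "set v \<subseteq> X" "p v \<in> carrier R"
      using insert.prems insert.hyps(4) by (auto simp: free_carrier_iff word_supp_def)
    have "p = (p v \<odot>\<^bsub>Fr X\<^esub> free_word R v) \<oplus>\<^bsub>Fr X\<^esub> q"
      using insert.prems by (auto simp: free_simps free_word_def q_def fun_eq_iff free_carrier_iff)
    moreover have "P \<dots>"
      using insert.hyps(3)[OF S q] v q free_word_closed[OF v(1,2)]
      by (intro add smult word) (auto simp: free_simps free_closed)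
    ultimately show ?case by simp
  qed
qed

lemma lin_sum:
  assumes M: "module R M" and h: "\<And>w. w \<noteq> [] \<Longrightarrow> set w \<subseteq> X \<Longrightarrow> h w \<in> carrier M"
  defines "L \<equiv> \<lambda>p. \<Oplus>\<^bsub>M\<^esub>w\<in>word_supp R p. p w \<odot>\<^bsub>M\<^esub> h w"
  shows "p \<in> carrier (Fr X) \<Longrightarrow> L p \<in> carrier M"
    and "p \<in> carrier (Fr X) \<Longrightarrow> q \<in> carrier (Fr X) \<Longrightarrow> L (p \<oplus>\<^bsub>Fr X\<^esub> q) = L p \<oplus>\<^bsub>M\<^esub> L q"
    and "a \<in> carrier R \<Longrightarrow> p \<in> carrier (Fr X) \<Longrightarrow> L (a \<odot>\<^bsub>Fr X\<^esub> p) = a \<odot>\<^bsub>M\<^esub> L p"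
    and "v \<noteq> [] \<Longrightarrow> set v \<subseteq> X \<Longrightarrow> L (free_word R v) = h v"
proof -
  interpret M: module R M by (rule M)
  have L: "L p = (\<Oplus>\<^bsub>M\<^esub>w\<in>T. p w \<odot>\<^bsub>M\<^esub> h w)"
    if "p \<in> carrier (Fr X)" "word_supp R p \<subseteq> T" "finite T" "T \<subseteq> lists X - {[]}" for p T
  proof -
    have hT: "h w \<in> carrier M" if "w \<in> T" for w using that h \<open>T \<subseteq> lists X - {[]}\<close> by auto
    show ?thesis unfolding L_def
      by (rule M.add.finprod_mono_neutral_cong_left)
         (use that hT in \<open>auto simp: free_carrier_iff word_supp_def\<close>)
  qed
  have supp: "word_supp R p \<subseteq> lists X - {[]}" "finite (word_supp R p)" if "p \<in> carrier (Fr X)" for p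
    using that by (auto simp: free_leibniz_def)
  { assume p: "p \<in> carrier (Fr X)"
    show "L p \<in> carrier M"
      unfolding L_def
      by (rule M.M.finsum_closed)
         (use p h in \<open>auto simp: free_carrier_iff word_supp_def Pi_def\<close>) }
  note Lc = this
  { assume p: "p \<in> carrier (Fr X)" and q: "q \<in> carrier (Fr X)"
    let ?T = "word_supp R p \<union> word_supp R q"
    have T: "finite ?T" "?T \<subseteq> lists X - {[]}" using supp[OF p] supp[OF q] by auto
    have hT: "h w \<in> carrier M" if "w \<in> ?T" for w using that h T(2) by auto
    have "p \<oplus>\<^bsub>Fr X\<^esub> q \<in> carrier (Fr X)" "word_supp R (p \<oplus>\<^bsub>Fr X\<^esub> q) \<subseteq> ?T"
      using p q by (auto simp: free_simps free_closed word_supp_def)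
    then have "L (p \<oplus>\<^bsub>Fr X\<^esub> q) = (\<Oplus>\<^bsub>M\<^esub>w\<in>?T. (p w \<oplus> q w) \<odot>\<^bsub>M\<^esub> h w)"
      using L[of "p \<oplus>\<^bsub>Fr X\<^esub> q" ?T] T by (simp add: free_simps)
    also have "\<dots> = (\<Oplus>\<^bsub>M\<^esub>w\<in>?T. p w \<odot>\<^bsub>M\<^esub> h w \<oplus>\<^bsub>M\<^esub> q w \<odot>\<^bsub>M\<^esub> h w)"
      by (rule M.M.finsum_cong') (use p q T hT in \<open>auto simp: free_carrier_iff M.smult_l_distr\<close>)
    also have "\<dots> = L p \<oplus>\<^bsub>M\<^esub> L q"
      using p q T hT by (subst M.M.finsum_addf) (auto simp: L[of p ?T] L[of q ?T] free_carrier_iff)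
    finally show "L (p \<oplus>\<^bsub>Fr X\<^esub> q) = L p \<oplus>\<^bsub>M\<^esub> L q" . }
  { assume a: "a \<in> carrier R" and p: "p \<in> carrier (Fr X)"
    have hT: "h w \<in> carrier M" if "w \<in> word_supp R p" for w
      using that h supp(1)[OF p] by auto
    have "a \<odot>\<^bsub>Fr X\<^esub> p \<in> carrier (Fr X)" "word_supp R (a \<odot>\<^bsub>Fr X\<^esub> p) \<subseteq> word_supp R p"
      using a p by (auto simp: free_simps free_closed word_supp_def)
    then have "L (a \<odot>\<^bsub>Fr X\<^esub> p) = (\<Oplus>\<^bsub>M\<^esub>w\<in>word_supp R p. (a \<otimes> p w) \<odot>\<^bsub>M\<^esub> h w)"
      using L[of "a \<odot>\<^bsub>Fr X\<^esub> p" "word_supp R p"] supp[OF p] by (simp add: free_simps)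
    also have "\<dots> = (\<Oplus>\<^bsub>M\<^esub>w\<in>word_supp R p. a \<odot>\<^bsub>M\<^esub> (p w \<odot>\<^bsub>M\<^esub> h w))"
      by (rule M.M.finsum_cong') (use a p supp[OF p] hT in \<open>auto simp: free_carrier_iff M.smult_assoc1\<close>)
    also have "\<dots> = a \<odot>\<^bsub>M\<^esub> L p"
      unfolding L_def
      by (rule M.finsum_smult_ldistr[symmetric]) (use a p supp[OF p] hT in \<open>auto simp: free_carrier_iff\<close>)
    finally show "L (a \<odot>\<^bsub>Fr X\<^esub> p) = a \<odot>\<^bsub>M\<^esub> L p" . }
  { assume v: "v \<noteq> []" "set v \<subseteq> X"
    show "L (free_word R v) = h v"
      using h[OF v] unfolding L_def word_supp_free_word
      by (simp add: free_word_def) }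
qed

definition linear_on where
  "linear_on X M L \<longleftrightarrow> (\<forall>p\<in>carrier (Fr X). L p \<in> carrier M) \<and>
     (\<forall>p\<in>carrier (Fr X). \<forall>q\<in>carrier (Fr X). L (p \<oplus>\<^bsub>Fr X\<^esub> q) = L p \<oplus>\<^bsub>M\<^esub> L q) \<and>
     (\<forall>a\<in>carrier R. \<forall>p\<in>carrier (Fr X). L (a \<odot>\<^bsub>Fr X\<^esub> p) = a \<odot>\<^bsub>M\<^esub> L p)"

lemma linear_onD:
  assumes "linear_on X M L"
  shows "p \<in> carrier (Fr X) \<Longrightarrow> L p \<in> carrier M"
    and "p \<in> carrier (Fr X) \<Longrightarrow> q \<in> carrier (Fr X) \<Longrightarrow> L (p \<oplus>\<^bsub>Fr X\<^esub> q) = L p \<oplus>\<^bsub>M\<^esub> L q"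
    and "a \<in> carrier R \<Longrightarrow> p \<in> carrier (Fr X) \<Longrightarrow> L (a \<odot>\<^bsub>Fr X\<^esub> p) = a \<odot>\<^bsub>M\<^esub> L p"
  using assms by (auto simp: linear_on_def)

lemma linear_on_ext:
  assumes M: "module R M" and L: "linear_on X M L" and L': "linear_on X M L'"
    and eq: "\<And>v. v \<noteq> [] \<Longrightarrow> set v \<subseteq> X \<Longrightarrow> L (free_word R v) = L' (free_word R v)"
    and p: "p \<in> carrier (Fr X)"
  shows "L p = L' p"
proof -
  interpret M: module R M by (rule M)
  have z: "L0 \<zero>\<^bsub>Fr X\<^esub> = \<zero>\<^bsub>M\<^esub>" if "linear_on X M L0" for L0
  proof -
    have c: "\<zero>\<^bsub>Fr X\<^esub> \<in> carrier (Fr X)" by (simp add: free_simps free_closed)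
    have "L0 (\<zero> \<odot>\<^bsub>Fr X\<^esub> \<zero>\<^bsub>Fr X\<^esub>) = \<zero> \<odot>\<^bsub>M\<^esub> L0 \<zero>\<^bsub>Fr X\<^esub>"
      using linear_onD(3)[OF that _ c] by simp
    then show ?thesis using linear_onD(1)[OF that c] by (simp add: free_simps)
  qed
  show ?thesis using p
    by (induction rule: free_induct) (simp_all add: z L L' eq linear_onD[OF L] linear_onD[OF L'])
qed

lemma linear_append: 
  assumes x: "x \<in> X" shows "linear_on X (Fr X) (append_letter R x)"
proof -
  have "append_letter R x p \<in> carrier (Fr X)" if p: "p \<in> carrier (Fr X)" for p
  proof -
    have "word_supp R (append_letter R x p) \<subseteq> (\<lambda>w. w @ [x]) ` word_supp R p"
      by (auto simp: word_supp_def append_letter_def image_iff)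
         (metis append_butlast_last_id)
    then have "finite (word_supp R (append_letter R x p))"
      using p by (meson finite_imageI finite_subset free_carrier_iff)
    moreover have "set w \<subseteq> X" if "w \<noteq> []" "last w = x" "p (butlast w) \<noteq> \<zero>" for w
    proof -
      have "set (butlast w) \<subseteq> X" using p that by (auto simp: free_carrier_iff)
      moreover have "set w = insert x (set (butlast w))"
        using that by (metis append_butlast_last_id list.simps(15) rotate1.simps(2) set_rotate1)
      ultimately show ?thesis using x by simp
    qed
    ultimately show ?thesis
      using p by (auto simp: free_carrier_iff append_letter_def)
  qed
  then show ?thesis
    by (auto simp: linear_on_def free_simps append_letter_def fun_eq_iff free_carrier_iff)
qed

lemma linear_minus:
  assumes M: "module R M" and L: "linear_on X M L" and L': "linear_on X M L'"
  shows "linear_on X M (\<lambda>p. L p \<ominus>\<^bsub>M\<^esub> L' p)"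
proof -
  interpret M: module R M by (rule M)
  show ?thesis unfolding linear_on_def
    by (auto simp: linear_onD[OF L] linear_onD[OF L'] M.minus_eq M.smult_r_distr M.smult_r_minus
        M.M.minus_add M.M.a_ac)
qed

lemma linear_comp:
  assumes "linear_on X (Fr X) L" "linear_on X M L'"
  shows "linear_on X M (\<lambda>p. L' (L p))"
  unfolding linear_on_def by (auto simp: linear_onD[OF assms(1)] linear_onD[OF assms(2)])

lemma word_act_Cons:
  assumes "v \<noteq> []" "set v \<subseteq> X" "x \<in> X" "linear_on X (Fr X) (word_act R v)" "p \<in> carrier (Fr X)"
  shows "word_act R (x # v) p =
    append_letter R x (word_act R v p) \<ominus>\<^bsub>Fr X\<^esub> word_act R v (append_letter R x p)"
proof -
  obtain y u where v: "v = y # u" using assms(1) by (cases v) auto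
  show ?thesis
    using assms free_minus[of "append_letter R x (word_act R v p)" X "word_act R v (append_letter R x p)"]
      linear_onD(1)[OF linear_append[OF assms(3)]] linear_onD(1)[OF assms(4)]
    by (simp add: v)
qed

lemma linear_word_act:
  "v \<noteq> [] \<Longrightarrow> set v \<subseteq> X \<Longrightarrow> linear_on X (Fr X) (word_act R v)"
proof (induction v)
  case (Cons x v)
  show ?case
  proof (cases "v = []")
    case True
    then show ?thesis using Cons.prems linear_append[of x X] by (simp add: linear_on_def)
  next
    case False
    have x: "x \<in> X" and v: "set v \<subseteq> X" using Cons.prems by auto
    have L: "linear_on X (Fr X) (word_act R v)" using Cons.IH False v by simp
    note A = linear_append[OF x]
    have L': "linear_on X (Fr X) (\<lambda>p. append_letter R x (word_act R v p) \<ominus>\<^bsub>Fr X\<^esub> word_act R v (append_letter R x p))"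
      by (rule linear_minus[OF free_module linear_comp[OF L A] linear_comp[OF A L]])
    interpret F: module R "Fr X" by (rule free_module)
    show ?thesis
      unfolding linear_on_def
      using linear_onD[OF L'] by (simp add: word_act_Cons[OF False v x L])
  qed
qed simp

lemma free_bracket_alt:
  assumes p: "p \<in> carrier (Fr X)" and q: "q \<in> carrier (Fr X)"
  shows "\<lblot>p, q\<rblot>\<^bsub>Fr X\<^esub> = (\<Oplus>\<^bsub>Fr X\<^esub>v\<in>word_supp R q. q v \<odot>\<^bsub>Fr X\<^esub> word_act R (rev v) p)"
proof -
  interpret F: module R "Fr X" by (rule free_module)
  have *: "(\<Oplus>\<^bsub>Fr X\<^esub>v\<in>T. q v \<odot>\<^bsub>Fr X\<^esub> word_act R (rev v) p)
       = (\<lambda>w. \<Oplus>v\<in>T. q v \<otimes> word_act R (rev v) p w)" if "finite T" "T \<subseteq> lists X - {[]}" for T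
    using that
  proof induction
    case empty
    then show ?case by (simp add: free_simps)
  next
    case (insert u T)
    have W: "word_act R (rev v) p \<in> carrier (Fr X)" if "v \<in> insert u T" for v
      by (rule linear_onD(1)[OF linear_word_act p]) (use that insert.prems in auto)
    have qc: "q v \<in> carrier R" for v using q by (simp add: free_carrier_iff)
    have Wc: "word_act R (rev v) p w \<in> carrier R" if "v \<in> insert u T" for v w
      using W[OF that] by (simp add: free_carrier_iff)
    show ?case using insert W qc Wc
      by (subst F.M.finsum_insert) (auto simp: free_simps(2,3) free_closed(4) fun_eq_iff)
  qed
  show ?thesis using q by (subst *) (auto simp: free_simps free_carrier_iff word_supp_def)
qed

lemma bracket_linear_right: "p \<in> carrier (Fr X) \<Longrightarrow> linear_on X (Fr X) (bracket (Fr X) p)"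
  and bracket_word: "p \<in> carrier (Fr X) \<Longrightarrow> v \<noteq> [] \<Longrightarrow> set v \<subseteq> X \<Longrightarrow>
    \<lblot>p, free_word R v\<rblot>\<^bsub>Fr X\<^esub> = word_act R (rev v) p"
proof -
  assume p: "p \<in> carrier (Fr X)"
  interpret F: module R "Fr X" by (rule free_module)
  have W: "word_act R (rev v) p \<in> carrier (Fr X)" if "v \<noteq> []" "set v \<subseteq> X" for v
    by (rule linear_onD(1)[OF linear_word_act p]) (use that in auto)
  note * = lin_sum[OF free_module, of X "\<lambda>v. word_act R (rev v) p", OF W]
  show "linear_on X (Fr X) (bracket (Fr X) p)"
    unfolding linear_on_def using * by (simp add: free_bracket_alt[OF p])
  show "\<lblot>p, free_word R v\<rblot>\<^bsub>Fr X\<^esub> = word_act R (rev v) p" if "v \<noteq> []" "set v \<subseteq> X"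
    using *(4)[OF _ _ that] free_word_closed[OF that] by (simp add: free_bracket_alt[OF p])
qed

lemma bracket_linear_left:
  assumes q: "q \<in> carrier (Fr X)" shows "linear_on X (Fr X) (\<lambda>p. \<lblot>p, q\<rblot>\<^bsub>Fr X\<^esub>)"
proof -
  interpret F: module R "Fr X" by (rule free_module)
  note R = linear_onD[OF bracket_linear_right]
  have z: "\<lblot>p, \<zero>\<^bsub>Fr X\<^esub>\<rblot>\<^bsub>Fr X\<^esub> = \<zero>\<^bsub>Fr X\<^esub>" for p
    by (simp add: free_simps word_supp_def)
  show ?thesis using q
  proof (induction rule: free_induct)
    case zero
    then show ?case by (simp add: z linear_on_def)
  next
    case (word v)
    note L = linear_onD[OF linear_word_act[of "rev v" X]]
    show ?case using word L unfolding linear_on_def by (simp add: bracket_word)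
  next
    case (add q r)
    note L = linear_onD[OF add(3)] linear_onD[OF add(4)]
    show ?case unfolding linear_on_def using add(1,2)
      by (auto simp: R L F.M.a_ac F.smult_r_distr)
  next
    case (smult a q)
    note L = linear_onD[OF smult(3)]
    show ?case unfolding linear_on_def using smult(1,2)
      by (auto simp: R L F.smult_r_distr F.smult_assoc1[symmetric] m_comm)
  qed
qed

lemma append_free_word: "append_letter R x (free_word R v) = free_word R (v @ [x])"
  by (auto simp: append_letter_def free_word_def fun_eq_iff)

lemma bracket_append:
  assumes p: "p \<in> carrier (Fr X)" and q: "q \<in> carrier (Fr X)" and x: "x \<in> X"
  shows "\<lblot>p, append_letter R x q\<rblot>\<^bsub>Fr X\<^esub> =
    append_letter R x \<lblot>p, q\<rblot>\<^bsub>Fr X\<^esub> \<ominus>\<^bsub>Fr X\<^esub> \<lblot>append_letter R x p, q\<rblot>\<^bsub>Fr X\<^esub>"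
proof -
  note A = linear_append[OF x]
  have p': "append_letter R x p \<in> carrier (Fr X)" by (rule linear_onD(1)[OF A p])
  show ?thesis
  proof (rule linear_on_ext[OF free_module _ _ _ q])
    show "linear_on X (Fr X) (\<lambda>q. \<lblot>p, append_letter R x q\<rblot>\<^bsub>Fr X\<^esub>)"
      by (rule linear_comp[OF A bracket_linear_right[OF p]])
    show "linear_on X (Fr X) (\<lambda>q. append_letter R x \<lblot>p, q\<rblot>\<^bsub>Fr X\<^esub> \<ominus>\<^bsub>Fr X\<^esub> \<lblot>append_letter R x p, q\<rblot>\<^bsub>Fr X\<^esub>)"
      by (rule linear_minus[OF free_module linear_comp[OF bracket_linear_right[OF p] A]
          bracket_linear_right[OF p']])
    fix v assume v: "v \<noteq> []" "set v \<subseteq> X"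
    have L: "linear_on X (Fr X) (word_act R (rev v))" by (rule linear_word_act) (use v in auto)
    show "\<lblot>p, append_letter R x (free_word R v)\<rblot>\<^bsub>Fr X\<^esub> =
      append_letter R x \<lblot>p, free_word R v\<rblot>\<^bsub>Fr X\<^esub> \<ominus>\<^bsub>Fr X\<^esub> \<lblot>append_letter R x p, free_word R v\<rblot>\<^bsub>Fr X\<^esub>"
      using v x p p' word_act_Cons[OF _ _ x L p]
      by (simp add: append_free_word bracket_word)
  qed
qed

lemma bracket_word_act:
  assumes "u \<noteq> []" "set u \<subseteq> X" and p: "p \<in> carrier (Fr X)" and q: "q \<in> carrier (Fr X)"
  shows "\<lblot>p, word_act R u q\<rblot>\<^bsub>Fr X\<^esub> =
    word_act R u \<lblot>p, q\<rblot>\<^bsub>Fr X\<^esub> \<ominus>\<^bsub>Fr X\<^esub> \<lblot>word_act R u p, q\<rblot>\<^bsub>Fr X\<^esub>"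
  using assms
proof (induction u arbitrary: p q)
  case (Cons x u)
  interpret F: module R "Fr X" by (rule free_module)
  have x: "x \<in> X" and u: "set u \<subseteq> X" using Cons.prems by auto
  note A = linear_append[OF x]
  show ?case
  proof (cases "u = []")
    case True
    then show ?thesis using bracket_append[OF _ _ x] Cons.prems by simp
  next
    case False
    note W = linear_word_act[OF False u]
    note Ac = linear_onD(1)[OF A] and Wc = linear_onD(1)[OF W]
    note Bc = linear_onD(1)[OF bracket_linear_right]
    have sub: "L (a \<ominus>\<^bsub>Fr X\<^esub> b) = L a \<ominus>\<^bsub>Fr X\<^esub> L b"
      if L: "linear_on X (Fr X) L" and "a \<in> carrier (Fr X)" "b \<in> carrier (Fr X)" for L a b
    proof -
      have "L a = L ((a \<ominus>\<^bsub>Fr X\<^esub> b) \<oplus>\<^bsub>Fr X\<^esub> b)"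
        using that by (simp add: F.minus_eq F.M.a_assoc F.M.l_neg)
      then have "L a = L (a \<ominus>\<^bsub>Fr X\<^esub> b) \<oplus>\<^bsub>Fr X\<^esub> L b"
        using that linear_onD(2)[OF L] by simp
      then show ?thesis
        using that linear_onD(1)[OF L] by (simp add: F.minus_eq F.M.a_assoc F.M.r_neg)
    qed
    note IH = Cons.IH[OF False u] and BA = bracket_append[OF _ _ x]
    note p = Cons.prems(3) and q = Cons.prems(4)
    note cons = word_act_Cons[OF False u x W]
    show ?thesis
      using p q
      by (simp add: cons sub[OF bracket_linear_right] sub[OF bracket_linear_left] sub[OF A] sub[OF W]
          Ac Wc Bc IH BA F.M.minus_cancel_aux)
  qed
qed simp

theorem free_leibniz_algebra: "leibniz_algebra R (Fr X)"
proof -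
  interpret F: module R "Fr X" by (rule free_module)
  note Rl = linear_onD[OF bracket_linear_right] and Ll = linear_onD[OF bracket_linear_left]
  show ?thesis
  proof
    fix p q r assume p: "p \<in> carrier (Fr X)" and q: "q \<in> carrier (Fr X)" and r: "r \<in> carrier (Fr X)"
    have pq: "\<lblot>p, q\<rblot>\<^bsub>Fr X\<^esub> \<in> carrier (Fr X)" using p q by (simp add: Rl)
    show "\<lblot>p, \<lblot>q, r\<rblot>\<^bsub>Fr X\<^esub>\<rblot>\<^bsub>Fr X\<^esub> = \<lblot>\<lblot>p, q\<rblot>\<^bsub>Fr X\<^esub>, r\<rblot>\<^bsub>Fr X\<^esub> \<ominus>\<^bsub>Fr X\<^esub> \<lblot>\<lblot>p, r\<rblot>\<^bsub>Fr X\<^esub>, q\<rblot>\<^bsub>Fr X\<^esub>"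
    proof (rule linear_on_ext[OF free_module _ _ _ r])
      show "linear_on X (Fr X) (\<lambda>r. \<lblot>p, \<lblot>q, r\<rblot>\<^bsub>Fr X\<^esub>\<rblot>\<^bsub>Fr X\<^esub>)"
        by (rule linear_comp[OF bracket_linear_right[OF q] bracket_linear_right[OF p]])
      show "linear_on X (Fr X) (\<lambda>r. \<lblot>\<lblot>p, q\<rblot>\<^bsub>Fr X\<^esub>, r\<rblot>\<^bsub>Fr X\<^esub> \<ominus>\<^bsub>Fr X\<^esub> \<lblot>\<lblot>p, r\<rblot>\<^bsub>Fr X\<^esub>, q\<rblot>\<^bsub>Fr X\<^esub>)"
        by (rule linear_minus[OF free_module bracket_linear_right[OF pq]
              linear_comp[OF bracket_linear_right[OF p] bracket_linear_left[OF q]]])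
    qed (use p q pq in \<open>simp add: bracket_word bracket_word_act\<close>)
  qed (auto simp: Rl Ll)
qed

lemma free_hom_unique:
  fixes X :: "'x set"
  assumes A: "leibniz_algebra R A"
    and h: "h \<in> leibniz_hom R (Fr X) A" and h': "h' \<in> leibniz_hom R (Fr X) A"
    and eq: "\<And>x. x \<in> X \<Longrightarrow> h (free_letter R x) = h' (free_letter R x)"
    and p: "p \<in> carrier (Fr X)"
  shows "h p = h' p"
proof -
  interpret A: leibniz_algebra R A by (rule A)
  have lin: "linear_on X A k" if "k \<in> leibniz_hom R (Fr X) A" for k
    using that by (auto simp: leibniz_hom_def linear_on_def)
  have letter: "\<lblot>free_word R v, free_letter R x\<rblot>\<^bsub>Fr X\<^esub> = free_word R (v @ [x])"
    if "v \<noteq> []" "set v \<subseteq> X" "x \<in> X" for v x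
    using bracket_word[OF free_word_closed[OF that(1,2)], of "[x]"] that
    by (simp add: free_letter_def append_free_word)
  show ?thesis
  proof (rule linear_on_ext[OF A.G.module_axioms lin[OF h] lin[OF h'] _ p])
    fix v :: "'x list" assume "v \<noteq> []" "set v \<subseteq> X"
    then show "h (free_word R v) = h' (free_word R v)"
    proof (induction v rule: rev_nonempty_induct)
      case (single x)
      then show ?case using eq by (simp add: free_letter_def)
    next
      case (snoc x v)
      have v: "set v \<subseteq> X" and x: "x \<in> X" using snoc.prems by auto
      have "free_word R v \<in> carrier (Fr X)" "free_letter R x \<in> carrier (Fr X)"
        unfolding free_letter_def using snoc.hyps v x by (auto intro!: free_word_closed)
      then show ?case
        using h h' snoc.IH[OF v] eq[OF x] letter[OF snoc.hyps v x, symmetric]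
        by (simp add: leibniz_hom_def)
    qed
  qed
qed

theorem free_lift_hom:
  assumes A: "leibniz_algebra R A" and f: "f \<in> X \<rightarrow> carrier A"
  shows "free_lift R A f \<in> leibniz_hom R (Fr X) A"
    and "x \<in> X \<Longrightarrow> free_lift R A f (free_letter R x) = f x"
proof -
  interpret A: leibniz_algebra R A by (rule A)
  interpret F: leibniz_algebra R "Fr X" by (rule free_leibniz_algebra)
  let ?L = "free_lift R A f" and ?n = "\<lambda>v. left_normed A (map f v)"
  have n_snoc: "?n (v @ [x]) = \<lblot>?n v, f x\<rblot>\<^bsub>A\<^esub>" if "v \<noteq> []" for v x
    using that by (cases v) auto
  have n: "?n v \<in> carrier A" if "v \<noteq> []" "set v \<subseteq> X" for v
    using that
  proof (induction v rule: rev_nonempty_induct)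
    case (snoc x v)
    then show ?case using f by (auto simp: n_snoc simp del: map_append)
  qed (use f in auto)
  note L = lin_sum[OF A.G.module_axioms, of X ?n, OF n, folded free_lift_def]
  have lin: "linear_on X A ?L" using L(1-3) by (simp add: linear_on_def)
  have Lw: "?L (free_word R v) = ?n v" if "v \<noteq> []" "set v \<subseteq> X" for v
    using L(4)[OF _ _ that] .
  show "?L (free_letter R x) = f x" if "x \<in> X"
    using Lw[of "[x]"] that by (simp add: free_letter_def)
  have br_l: "linear_on X A (\<lambda>p. \<lblot>?L p, a\<rblot>\<^bsub>A\<^esub>)" if "a \<in> carrier A" for a
    using that by (auto simp: linear_on_def linear_onD[OF lin] A.bracket_add_left A.bracket_smult_left)
  have br_r: "linear_on X A (\<lambda>p. \<lblot>a, ?L p\<rblot>\<^bsub>A\<^esub>)" if "a \<in> carrier A" for a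
    using that by (auto simp: linear_on_def linear_onD[OF lin] A.bracket_add_right A.bracket_smult_right)
  have app: "?L (append_letter R x p) = \<lblot>?L p, f x\<rblot>\<^bsub>A\<^esub>" if x: "x \<in> X" and p: "p \<in> carrier (Fr X)" for x p
  proof (rule linear_on_ext[OF A.G.module_axioms linear_comp[OF linear_append[OF x] lin] br_l _ p])
    show "f x \<in> carrier A" using f x by auto
    show "?L (append_letter R x (free_word R v)) = \<lblot>?L (free_word R v), f x\<rblot>\<^bsub>A\<^esub>"
      if "v \<noteq> []" "set v \<subseteq> X" for v
      using that x by (simp add: append_free_word Lw n_snoc del: map_append)
  qed
  have act: "?L (word_act R u p) = \<lblot>?L p, ?n (rev u)\<rblot>\<^bsub>A\<^esub>"
    if "u \<noteq> []" "set u \<subseteq> X" "p \<in> carrier (Fr X)" for u p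
    using that
  proof (induction u arbitrary: p)
    case (Cons x u)
    have x: "x \<in> X" and u: "set u \<subseteq> X" using Cons.prems by auto
    have fx: "f x \<in> carrier A" using f x by auto
    show ?case
    proof (cases "u = []")
      case True
      then show ?thesis using app[OF x] Cons.prems by simp
    next
      case False
      note W = linear_word_act[OF False u]
      have sub: "?L (a \<ominus>\<^bsub>Fr X\<^esub> b) = ?L a \<ominus>\<^bsub>A\<^esub> ?L b"
        if "a \<in> carrier (Fr X)" "b \<in> carrier (Fr X)" for a b
      proof -
        have "?L a = ?L ((a \<ominus>\<^bsub>Fr X\<^esub> b) \<oplus>\<^bsub>Fr X\<^esub> b)"
          using that by (simp add: F.G.minus_eq F.G.M.a_assoc F.G.M.l_neg)
        then have "?L a = ?L (a \<ominus>\<^bsub>Fr X\<^esub> b) \<oplus>\<^bsub>A\<^esub> ?L b"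
          using that linear_onD(2)[OF lin] by simp
        then show ?thesis
          using that linear_onD(1)[OF lin] by (simp add: A.G.minus_eq A.G.M.a_assoc A.G.M.r_neg)
      qed
      have nu: "?n (rev u) \<in> carrier A" by (rule n) (use False u in auto)
      have rv: "?n (rev (x # u)) = \<lblot>?n (rev u), f x\<rblot>\<^bsub>A\<^esub>"
        using n_snoc[of "rev u" x] False by simp
      show ?thesis
        using Cons.prems(3) Cons.IH[OF False u] fx nu
        by (simp add: rv word_act_Cons[OF False u x W] sub app[OF x] linear_onD(1)[OF W]
            linear_onD(1)[OF linear_append[OF x]] linear_onD(1)[OF lin] A.leibniz_identity
            del: rev.simps map_append)
    qed
  qed simp
  have "?L \<lblot>p, q\<rblot>\<^bsub>Fr X\<^esub> = \<lblot>?L p, ?L q\<rblot>\<^bsub>A\<^esub>" if p: "p \<in> carrier (Fr X)" and q: "q \<in> carrier (Fr X)" for p q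
  proof (rule linear_on_ext[OF A.G.module_axioms linear_comp[OF bracket_linear_right[OF p] lin] br_r _ q])
    show "?L p \<in> carrier A" by (rule linear_onD(1)[OF lin p])
    show "?L \<lblot>p, free_word R v\<rblot>\<^bsub>Fr X\<^esub> = \<lblot>?L p, ?L (free_word R v)\<rblot>\<^bsub>A\<^esub>"
      if "v \<noteq> []" "set v \<subseteq> X" for v
      using act[of "rev v" p] that p by (simp add: bracket_word Lw)
  qed
  then show "?L \<in> leibniz_hom R (Fr X) A"
    using linear_onD[OF lin] by (simp add: leibniz_hom_def)
qed

end


section \<open>The second Lie-homology and stem covers\<close>

definition HL2 ::
  "('k, 'm) ring_scheme \<Rightarrow> ('k, 'f) leibniz \<Rightarrow> ('f \<Rightarrow> 'q) \<Rightarrow> ('k, 'q) leibniz \<Rightarrow> ('k, 'f set) leibniz"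
  where "HL2 K F \<tau> Q =
    leibniz_quot (F\<lparr>carrier := a_kernel F Q \<tau> \<inter> lie_comm K F (carrier F) (carrier F)\<rparr>)
      (lie_comm K F (a_kernel F Q \<tau>) (carrier F))"

text \<open>The map into the second homology, computed from the presentation \<open>\<tau> : F \<rightarrow> Q\<close>, that is induced
  by a lift \<open>\<phi>\<close> between free algebras.\<close>

definition HL2_map ::
  "('k, 'm) ring_scheme \<Rightarrow> ('k, 'f) leibniz \<Rightarrow> ('f \<Rightarrow> 'q) \<Rightarrow> ('k, 'q) leibniz \<Rightarrow>
    ('e \<Rightarrow> 'f) \<Rightarrow> 'e set \<Rightarrow> 'f set"
  where "HL2_map K F \<tau> Q \<phi> = quot_map F (lie_comm K F (a_kernel F Q \<tau>) (carrier F)) \<phi>"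

text \<open>As the standard free presentation of \<open>G\<close> we take the free Leibniz algebra on the underlying
  set of \<open>G\<close>; a homomorphism \<open>\<pi> : G \<rightarrow> Q\<close> then lifts to the homomorphism acting by \<open>\<pi>\<close> on the
  generators.\<close>

abbreviation std_free :: "('k, 'm) ring_scheme \<Rightarrow> ('k, 'g) leibniz \<Rightarrow> ('k, 'g list \<Rightarrow> 'k) leibniz"
  where "std_free K G \<equiv> free_leibniz K (carrier G)"

definition std_proj :: "('k, 'm) ring_scheme \<Rightarrow> ('k, 'g) leibniz \<Rightarrow> ('g list \<Rightarrow> 'k) \<Rightarrow> 'g"
  where "std_proj K G = free_lift K G (\<lambda>x. x)"

definition std_lift ::
  "('k, 'm) ring_scheme \<Rightarrow> ('g \<Rightarrow> 'q) \<Rightarrow> ('k, 'q) leibniz \<Rightarrow> ('g list \<Rightarrow> 'k) \<Rightarrow> 'q list \<Rightarrow> 'k"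
  where "std_lift K \<pi> Q = free_lift K (std_free K Q) (\<lambda>x. free_letter K (\<pi> x))"

text \<open>The standard presentation maps onto \<open>G\<close>, and \<open>std_lift\<close> does lift \<open>\<pi>\<close>.\<close>

lemma std_proj_hom:
  assumes G: "leibniz_algebra K G"
  shows "std_proj K G \<in> leibniz_hom K (std_free K G) G"
    and "x \<in> carrier G \<Longrightarrow> std_proj K G (free_letter K x) = x"
    and "std_proj K G ` carrier (std_free K G) = carrier G"
proof -
  interpret G: leibniz_algebra K G by (rule G)
  show 1: "std_proj K G \<in> leibniz_hom K (std_free K G) G"
    unfolding std_proj_def by (rule G.K.free_lift_hom(1)[OF G]) simp
  show 2: "std_proj K G (free_letter K x) = x" if "x \<in> carrier G" for x
    unfolding std_proj_def using G.K.free_lift_hom(2)[OF G _ that] by simp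
  have "free_letter K x \<in> carrier (std_free K G)" if "x \<in> carrier G" for x
    unfolding free_letter_def using that by (intro G.K.free_word_closed) auto
  with 1 2 show "std_proj K G ` carrier (std_free K G) = carrier G"
    by (auto simp: leibniz_hom_def Pi_def image_iff) metis
qed

lemma std_lift_hom:
  assumes G: "leibniz_algebra K G" and Q: "leibniz_algebra K Q" and \<pi>: "\<pi> \<in> leibniz_hom K G Q"
  shows "std_lift K \<pi> Q \<in> leibniz_hom K (std_free K G) (std_free K Q)"
    and "p \<in> carrier (std_free K G) \<Longrightarrow> std_proj K Q (std_lift K \<pi> Q p) = \<pi> (std_proj K G p)"
proof -
  interpret G: leibniz_algebra K G by (rule G)
  let ?f = "\<lambda>x. free_letter K (\<pi> x)"
  have \<pi>c: "\<pi> x \<in> carrier Q" if "x \<in> carrier G" for x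
    using \<pi> that by (auto simp: leibniz_hom_def)
  have f: "?f \<in> carrier G \<rightarrow> carrier (std_free K Q)"
    using \<pi>c unfolding free_letter_def by (auto intro!: G.K.free_word_closed)
  note l = G.K.free_lift_hom[OF G.K.free_leibniz_algebra f, folded std_lift_def]
  show 1: "std_lift K \<pi> Q \<in> leibniz_hom K (std_free K G) (std_free K Q)"
    by (rule l(1))
  have comp: "(\<lambda>p. h' (h p)) \<in> leibniz_hom K A C"
    if "h \<in> leibniz_hom K A B" "h' \<in> leibniz_hom K B C"
    for h h' and A :: "('a, 'g list \<Rightarrow> 'a) leibniz" and B :: "('a, 'y) leibniz" and C :: "('a, 'z) leibniz"
    using that by (auto simp: leibniz_hom_def Pi_def)
  show "std_proj K Q (std_lift K \<pi> Q p) = \<pi> (std_proj K G p)" if "p \<in> carrier (std_free K G)"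
    by (rule G.K.free_hom_unique[OF Q comp[OF 1 std_proj_hom(1)[OF Q]]
        comp[OF std_proj_hom(1)[OF G] \<pi>] _ that])
       (simp add: l(2) std_proj_hom(2)[OF Q] std_proj_hom(2)[OF G] \<pi>c)
qed

abbreviation std_HL2 :: "('k, 'm) ring_scheme \<Rightarrow> ('k, 'g) leibniz \<Rightarrow> ('k, ('g list \<Rightarrow> 'k) set) leibniz"
  where "std_HL2 K G \<equiv> HL2 K (std_free K G) (std_proj K G) G"

abbreviation std_HL2_map ::
  "('k, 'm) ring_scheme \<Rightarrow> ('g \<Rightarrow> 'q) \<Rightarrow> ('k, 'q) leibniz \<Rightarrow> ('g list \<Rightarrow> 'k) set \<Rightarrow> ('q list \<Rightarrow> 'k) set"
  where "std_HL2_map K \<pi> Q \<equiv> HL2_map K (std_free K Q) (std_proj K Q) Q (std_lift K \<pi> Q)"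

definition lie_stem_extension ::
  "('k, 'm) ring_scheme \<Rightarrow> ('k, 'n) leibniz \<Rightarrow> ('n \<Rightarrow> 'g) \<Rightarrow>
    ('k, 'g) leibniz \<Rightarrow> ('g \<Rightarrow> 'q) \<Rightarrow> ('k, 'q) leibniz \<Rightarrow> bool"
  where "lie_stem_extension K N \<chi> G \<pi> Q \<longleftrightarrow>
    lie_central_extension K N \<chi> G \<pi> Q \<and>
    quot_map Q (square_span K Q) \<pi> \<in> leibniz_iso K (liezation K G) (liezation K Q)"

definition lie_stem_cover ::
  "('k, 'm) ring_scheme \<Rightarrow> ('k, 'n) leibniz \<Rightarrow> ('n \<Rightarrow> 'g) \<Rightarrow>
    ('k, 'g) leibniz \<Rightarrow> ('g \<Rightarrow> 'q) \<Rightarrow> ('k, 'q) leibniz \<Rightarrow> bool"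
  where "lie_stem_cover K N \<chi> G \<pi> Q \<longleftrightarrow>
    lie_stem_extension K N \<chi> G \<pi> Q \<and>
    (\<forall>A\<in>carrier (std_HL2 K G). std_HL2_map K \<pi> Q A = \<zero>\<^bsub>std_HL2 K Q\<^esub>)"

end

theory Submission
  imports Defs
begin

text \<open>Let \<open>F\<close> be the standard free algebra on \<open>Q\<close>, with kernel \<open>R\<close> of \<open>p : F \<rightarrow> Q\<close>. For a stem cover
  \<open>\<pi> : G \<rightarrow> Q\<close> choose a section \<open>s\<close> of the induced map of standard free algebras and let
  \<open>h : F \<rightarrow> G\<close> be \<open>s\<close> followed by the projection to \<open>G\<close>, so that \<open>\<pi> \<circ> h = p\<close>. Symmetrised brackets
  in \<open>G\<close> only depend on their arguments modulo the kernel of \<open>\<pi>\<close>, hence \<open>h\<close> maps \<open>[F, F]\<^sub>L\<^sub>i\<^sub>e\<close> onto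
  \<open>[G, G]\<^sub>L\<^sub>i\<^sub>e\<close> and kills \<open>[R, F]\<^sub>L\<^sub>i\<^sub>e\<close>; that the map on second Lie-homology vanishes says that nothing
  else in \<open>[F, F]\<^sub>L\<^sub>i\<^sub>e\<close> is killed. So \<open>[G, G]\<^sub>L\<^sub>i\<^sub>e\<close> is \<open>[F, F]\<^sub>L\<^sub>i\<^sub>e / [R, F]\<^sub>L\<^sub>i\<^sub>e\<close> for every stem cover \<open>G\<close>.\<close>

abbreviation sym_bracket :: "('k, 'a, 'n) leibniz_scheme \<Rightarrow> 'a \<Rightarrow> 'a \<Rightarrow> 'a"
  where "sym_bracket G x y \<equiv> \<lblot>x, y\<rblot>\<^bsub>G\<^esub> \<oplus>\<^bsub>G\<^esub> \<lblot>y, x\<rblot>\<^bsub>G\<^esub>"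

lemma leibniz_homD:
  assumes "h \<in> leibniz_hom K G H"
  shows "x \<in> carrier G \<Longrightarrow> h x \<in> carrier H"
    and "\<lbrakk>x \<in> carrier G; y \<in> carrier G\<rbrakk> \<Longrightarrow> h (x \<oplus>\<^bsub>G\<^esub> y) = h x \<oplus>\<^bsub>H\<^esub> h y"
    and "\<lbrakk>a \<in> carrier K; x \<in> carrier G\<rbrakk> \<Longrightarrow> h (a \<odot>\<^bsub>G\<^esub> x) = a \<odot>\<^bsub>H\<^esub> h x"
    and "\<lbrakk>x \<in> carrier G; y \<in> carrier G\<rbrakk> \<Longrightarrow> h \<lblot>x, y\<rblot>\<^bsub>G\<^esub> = \<lblot>h x, h y\<rblot>\<^bsub>H\<^esub>"
  using assms by (auto simp: leibniz_hom_def)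

lemma leibniz_hom_comp:
  assumes "f \<in> leibniz_hom K A B" and "g \<in> leibniz_hom K B C"
  shows "g \<circ> f \<in> leibniz_hom K A C"
  using assms by (auto simp: leibniz_hom_def Pi_def)

lemma leibniz_hom_id: "(\<lambda>x. x) \<in> leibniz_hom K G G"
  by (simp add: leibniz_hom_def)

section \<open>Symmetrised brackets in a Leibniz algebra\<close>

context leibniz_algebra begin

lemma diff_add_cancel:
  "\<lbrakk>x \<in> carrier G; y \<in> carrier G\<rbrakk> \<Longrightarrow> (x \<ominus>\<^bsub>G\<^esub> y) \<oplus>\<^bsub>G\<^esub> y = x"
  by (simp add: G.M.minus_eq G.M.a_assoc G.M.l_neg)

lemma diff_eq_zero_iff:
  "\<lbrakk>x \<in> carrier G; y \<in> carrier G\<rbrakk> \<Longrightarrow> x \<ominus>\<^bsub>G\<^esub> y = \<zero>\<^bsub>G\<^esub> \<longleftrightarrow> x = y"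
  using diff_add_cancel[of x y] by (auto simp: G.M.minus_eq G.M.r_neg)

lemma bracket_zero [simp]:
  assumes x: "x \<in> carrier G"
  shows "\<lblot>x, \<zero>\<^bsub>G\<^esub>\<rblot>\<^bsub>G\<^esub> = \<zero>\<^bsub>G\<^esub>" and "\<lblot>\<zero>\<^bsub>G\<^esub>, x\<rblot>\<^bsub>G\<^esub> = \<zero>\<^bsub>G\<^esub>"
  using bracket_smult_right[of "\<zero>\<^bsub>K\<^esub>" x x] bracket_smult_left[of "\<zero>\<^bsub>K\<^esub>" x x] x
  by simp_all

lemma sym_bracket_closed [simp]:
  "\<lbrakk>x \<in> carrier G; y \<in> carrier G\<rbrakk> \<Longrightarrow> sym_bracket G x y \<in> carrier G"
  by simp

lemma sym_bracket_commute:
  "\<lbrakk>x \<in> carrier G; y \<in> carrier G\<rbrakk> \<Longrightarrow> sym_bracket G x y = sym_bracket G y x"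
  by (simp add: G.M.a_comm)

text \<open>The Leibniz identity turns \<open>[z, [x, y]]\<close> into
  \<open>[[z, x], y] - [[z, y], x]\<close>, which changes sign when \<open>x\<close> and
  \<open>y\<close> are swapped. The two summands therefore cancel.\<close>

lemma bracket_sym_bracket:
  assumes "x \<in> carrier G" "y \<in> carrier G" "z \<in> carrier G"
  shows "\<lblot>z, sym_bracket G x y\<rblot>\<^bsub>G\<^esub> = \<zero>\<^bsub>G\<^esub>"
proof -
  let ?a = "\<lblot>\<lblot>z, x\<rblot>\<^bsub>G\<^esub>, y\<rblot>\<^bsub>G\<^esub>" and ?b = "\<lblot>\<lblot>z, y\<rblot>\<^bsub>G\<^esub>, x\<rblot>\<^bsub>G\<^esub>"
  have "\<lblot>z, sym_bracket G x y\<rblot>\<^bsub>G\<^esub> = (?a \<ominus>\<^bsub>G\<^esub> ?b) \<oplus>\<^bsub>G\<^esub> (?b \<ominus>\<^bsub>G\<^esub> ?a)"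
    using assms by (simp add: bracket_add_right leibniz_identity)
  also have "\<dots> = (?a \<oplus>\<^bsub>G\<^esub> \<ominus>\<^bsub>G\<^esub> ?a) \<oplus>\<^bsub>G\<^esub> (?b \<oplus>\<^bsub>G\<^esub> \<ominus>\<^bsub>G\<^esub> ?b)"
    using assms by (simp add: G.M.minus_eq G.M.a_ac del: G.M.r_neg)
  finally show ?thesis using assms by (simp add: G.M.r_neg)
qed

text \<open>The symmetrised bracket is additive in its first argument and vanishes on the
  Lie-center.\<close>

lemma sym_bracket_cong_left:
  assumes c: "x \<in> carrier G" "x' \<in> carrier G" "y \<in> carrier G"
    and z: "x \<ominus>\<^bsub>G\<^esub> x' \<in> lie_center G"
  shows "sym_bracket G x y = sym_bracket G x' y"
proof -
  let ?z = "x \<ominus>\<^bsub>G\<^esub> x'"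
  have zc: "?z \<in> carrier G" using c by simp
  have x: "x = ?z \<oplus>\<^bsub>G\<^esub> x'"
    using c by (simp add: diff_add_cancel)
  have z0: "sym_bracket G ?z y = \<zero>\<^bsub>G\<^esub>"
    using z c zc by (simp add: lie_center_def G.M.a_comm)
  have "sym_bracket G (?z \<oplus>\<^bsub>G\<^esub> x') y = sym_bracket G ?z y \<oplus>\<^bsub>G\<^esub> sym_bracket G x' y"
    using c zc by (simp add: bracket_add_left bracket_add_right G.M.a_ac)
  then show ?thesis using x z0 c by simp
qed

text \<open>This makes the commutator map of a Lie-central extension independent of the chosen
  preimages. Symmetry reduces the second argument to the first.\<close>

lemma sym_bracket_cong:
  assumes c: "x \<in> carrier G" "x' \<in> carrier G" "y \<in> carrier G" "y' \<in> carrier G"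
    and "x \<ominus>\<^bsub>G\<^esub> x' \<in> lie_center G" and "y \<ominus>\<^bsub>G\<^esub> y' \<in> lie_center G"
  shows "sym_bracket G x y = sym_bracket G x' y'"
proof -
  have "sym_bracket G x y = sym_bracket G x' y"
    by (rule sym_bracket_cong_left) fact+
  also have "\<dots> = sym_bracket G y x'" by (rule sym_bracket_commute) fact+
  also have "\<dots> = sym_bracket G y' x'" by (rule sym_bracket_cong_left) fact+
  also have "\<dots> = sym_bracket G x' y'" by (rule sym_bracket_commute) fact+
  finally show ?thesis .
qed

section \<open>Two-sided ideals and Lie-commutators\<close>

lemma leibniz_idealI:
  assumes "I \<subseteq> carrier G" and "\<zero>\<^bsub>G\<^esub> \<in> I"
    and "\<And>x y. \<lbrakk>x \<in> I; y \<in> I\<rbrakk> \<Longrightarrow> x \<oplus>\<^bsub>G\<^esub> y \<in> I"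
    and smult: "\<And>a x. \<lbrakk>a \<in> carrier K; x \<in> I\<rbrakk> \<Longrightarrow> a \<odot>\<^bsub>G\<^esub> x \<in> I"
    and "\<And>x y. \<lbrakk>x \<in> I; y \<in> carrier G\<rbrakk> \<Longrightarrow> \<lblot>x, y\<rblot>\<^bsub>G\<^esub> \<in> I"
    and "\<And>x y. \<lbrakk>x \<in> I; y \<in> carrier G\<rbrakk> \<Longrightarrow> \<lblot>y, x\<rblot>\<^bsub>G\<^esub> \<in> I"
  shows "leibniz_ideal K G I"
proof -
  have "\<ominus>\<^bsub>G\<^esub> x \<in> I" if "x \<in> I" for x
  proof -
    have x: "x \<in> carrier G" using that assms(1) by auto
    then have "\<ominus>\<^bsub>G\<^esub> x = (\<ominus>\<^bsub>K\<^esub> \<one>\<^bsub>K\<^esub>) \<odot>\<^bsub>G\<^esub> x" by (simp add: G.smult_l_minus)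
    then show ?thesis using smult[OF _ that, of "\<ominus>\<^bsub>K\<^esub> \<one>\<^bsub>K\<^esub>"] by simp
  qed
  then show ?thesis
    unfolding leibniz_ideal_def using assms by (auto intro!: G.submoduleI)
qed

lemma leibniz_idealD:
  assumes "leibniz_ideal K G I"
  shows "I \<subseteq> carrier G" and "\<zero>\<^bsub>G\<^esub> \<in> I"
    and "\<lbrakk>x \<in> I; y \<in> I\<rbrakk> \<Longrightarrow> x \<oplus>\<^bsub>G\<^esub> y \<in> I"
    and "x \<in> I \<Longrightarrow> \<ominus>\<^bsub>G\<^esub> x \<in> I"
    and "\<lbrakk>a \<in> carrier K; x \<in> I\<rbrakk> \<Longrightarrow> a \<odot>\<^bsub>G\<^esub> x \<in> I"
    and "\<lbrakk>x \<in> I; y \<in> carrier G\<rbrakk> \<Longrightarrow> \<lblot>x, y\<rblot>\<^bsub>G\<^esub> \<in> I"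
    and "\<lbrakk>x \<in> I; y \<in> carrier G\<rbrakk> \<Longrightarrow> \<lblot>y, x\<rblot>\<^bsub>G\<^esub> \<in> I"
proof -
  have s: "submodule I K G" using assms by (simp add: leibniz_ideal_def)
  note E = G.submoduleE[OF s]
  show "I \<subseteq> carrier G" by (rule E(1))
  show "\<lbrakk>x \<in> I; y \<in> I\<rbrakk> \<Longrightarrow> x \<oplus>\<^bsub>G\<^esub> y \<in> I" by (rule E(5))
  show "x \<in> I \<Longrightarrow> \<ominus>\<^bsub>G\<^esub> x \<in> I" by (rule E(3))
  show "\<lbrakk>a \<in> carrier K; x \<in> I\<rbrakk> \<Longrightarrow> a \<odot>\<^bsub>G\<^esub> x \<in> I" by (rule E(4))
  show "\<zero>\<^bsub>G\<^esub> \<in> I"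
    using subgroup.one_closed[OF submodule.axioms(1)[OF s]] by simp
qed (use assms in \<open>auto simp: leibniz_ideal_def\<close>)

lemma lie_comm_least:
  assumes "leibniz_ideal K G I" and "\<And>m n. \<lbrakk>m \<in> M; n \<in> N\<rbrakk> \<Longrightarrow> sym_bracket G m n \<in> I"
  shows "lie_comm K G M N \<subseteq> I"
  unfolding lie_comm_def leibniz_ideal_gen_def using assms by blast

lemma sym_bracket_in_lie_comm:
  "\<lbrakk>m \<in> M; n \<in> N\<rbrakk> \<Longrightarrow> sym_bracket G m n \<in> lie_comm K G M N"
  unfolding lie_comm_def leibniz_ideal_gen_def by blast

lemma carrier_ideal: "leibniz_ideal K G (carrier G)"
  by (rule leibniz_idealI) auto

lemma lie_comm_subset:
  assumes "M \<subseteq> carrier G" "N \<subseteq> carrier G"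
  shows "lie_comm K G M N \<subseteq> carrier G"
  using assms by (intro lie_comm_least carrier_ideal) (auto intro!: sym_bracket_closed)

lemma lie_comm_ideal:
  assumes "M \<subseteq> carrier G" "N \<subseteq> carrier G"
  shows "leibniz_ideal K G (lie_comm K G M N)"
proof (rule leibniz_idealI)
  show "lie_comm K G M N \<subseteq> carrier G" by (rule lie_comm_subset) fact+
qed (auto simp: lie_comm_def leibniz_ideal_gen_def intro: leibniz_idealD)

text \<open>The elements \<open>x\<close> with \<open>[y, x] = 0\<close> for all \<open>y\<close>
  form a two-sided ideal: \<open>[y, [x, z]]\<close> expands to
  \<open>[[y, x], z] - [[y, z], x]\<close>, where both terms vanish, and \<open>[z, x]\<close> is
  already zero. By \<open>bracket_sym_bracket\<close> this ideal contains all generators.\<close>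

lemma bracket_lie_comm:
  assumes y: "y \<in> carrier G" and x: "x \<in> lie_comm K G (carrier G) (carrier G)"
  shows "\<lblot>y, x\<rblot>\<^bsub>G\<^esub> = \<zero>\<^bsub>G\<^esub>"
proof -
  let ?A = "{x \<in> carrier G. \<forall>y\<in>carrier G. \<lblot>y, x\<rblot>\<^bsub>G\<^esub> = \<zero>\<^bsub>G\<^esub>}"
  have "lie_comm K G (carrier G) (carrier G) \<subseteq> ?A"
  proof (rule lie_comm_least)
    show "leibniz_ideal K G ?A"
      by (rule leibniz_idealI)
        (auto simp: bracket_add_right bracket_smult_right leibniz_identity G.M.minus_eq)
  qed (auto simp: bracket_sym_bracket)
  then show ?thesis using x y by blast
qed

end

section \<open>Homomorphisms and the images of Lie-commutators\<close>

context
  fixes K :: "('k, 'm) ring_scheme" and A :: "('k, 'a, 'n) leibniz_scheme"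
    and B :: "('k, 'b, 'o) leibniz_scheme" and h
  assumes A: "leibniz_algebra K A" and B: "leibniz_algebra K B" and h: "h \<in> leibniz_hom K A B"
begin

interpretation A: leibniz_algebra K A by (rule A)
interpretation B: leibniz_algebra K B by (rule B)

lemma leibniz_hom_zero: "h \<zero>\<^bsub>A\<^esub> = \<zero>\<^bsub>B\<^esub>"
proof -
  have "h \<zero>\<^bsub>A\<^esub> = h (\<zero>\<^bsub>K\<^esub> \<odot>\<^bsub>A\<^esub> \<zero>\<^bsub>A\<^esub>)" by simp
  also have "\<dots> = \<zero>\<^bsub>B\<^esub>"
    using leibniz_homD(1,3)[OF h] by (simp del: A.G.smult_l_null A.G.smult_r_null)
  finally show ?thesis .
qed

lemma leibniz_hom_diff:
  assumes "x \<in> carrier A" "y \<in> carrier A"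
  shows "h (x \<ominus>\<^bsub>A\<^esub> y) = h x \<ominus>\<^bsub>B\<^esub> h y"
proof -
  have "h (\<ominus>\<^bsub>A\<^esub> y) \<oplus>\<^bsub>B\<^esub> h y = \<zero>\<^bsub>B\<^esub>"
    using leibniz_homD(2)[OF h, of "\<ominus>\<^bsub>A\<^esub> y" y] assms by (simp add: A.G.M.l_neg leibniz_hom_zero)
  then have "\<ominus>\<^bsub>B\<^esub> h y = h (\<ominus>\<^bsub>A\<^esub> y)"
    using assms leibniz_homD(1)[OF h] by (intro B.G.M.minus_equality) auto
  then show ?thesis
    using assms leibniz_homD(2)[OF h] by (simp add: A.G.M.minus_eq B.G.M.minus_eq)
qed

lemma leibniz_hom_eq_iff:
  assumes "x \<in> carrier A" "y \<in> carrier A"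
  shows "h x = h y \<longleftrightarrow> h (x \<ominus>\<^bsub>A\<^esub> y) = \<zero>\<^bsub>B\<^esub>"
  using assms leibniz_homD(1)[OF h] by (simp add: leibniz_hom_diff B.diff_eq_zero_iff)

lemma leibniz_hom_sym_bracket:
  assumes "x \<in> carrier A" "y \<in> carrier A"
  shows "h (sym_bracket A x y) = sym_bracket B (h x) (h y)"
  using assms leibniz_homD[OF h] by simp

lemma kernel_ideal: "leibniz_ideal K A (a_kernel A B h)"
  by (rule A.leibniz_idealI)
    (auto simp: a_kernel_def' leibniz_hom_zero leibniz_homD[OF h])

text \<open>The preimage of an ideal is an ideal, and here it contains the symmetrised brackets of
  \<open>A\<close>.\<close>

lemma lie_comm_image_subset:
  "h ` lie_comm K A (carrier A) (carrier A) \<subseteq> lie_comm K B (carrier B) (carrier B)"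
proof -
  note I = B.leibniz_idealD[OF B.lie_comm_ideal[of "carrier B" "carrier B"]]
  have "lie_comm K A (carrier A) (carrier A)
    \<subseteq> {x \<in> carrier A. h x \<in> lie_comm K B (carrier B) (carrier B)}"
  proof (rule A.lie_comm_least)
    show "leibniz_ideal K A {x \<in> carrier A. h x \<in> lie_comm K B (carrier B) (carrier B)}"
      by (rule A.leibniz_idealI) (auto simp: leibniz_hom_zero leibniz_homD[OF h] intro: I(2-))
  qed (auto simp: leibniz_hom_sym_bracket leibniz_homD(1)[OF h]
      intro!: B.sym_bracket_in_lie_comm)
  then show ?thesis by auto
qed

text \<open>Surjectivity modulo the Lie-center is enough, since symmetrised brackets do not see
  central differences. The image of an ideal need not be an ideal when \<open>h\<close> is not onto,
  so closure under brackets with all of \<open>B\<close> needs its own argument.\<close>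

lemma lie_comm_image_eq:
  assumes surj: "\<And>y. y \<in> carrier B \<Longrightarrow> \<exists>x\<in>carrier A. y \<ominus>\<^bsub>B\<^esub> h x \<in> lie_center B"
  shows "h ` lie_comm K A (carrier A) (carrier A) = lie_comm K B (carrier B) (carrier B)"
proof
  let ?D = "lie_comm K A (carrier A) (carrier A)"
  note I = A.leibniz_idealD[OF A.lie_comm_ideal[of "carrier A" "carrier A"]]
  note hD = leibniz_homD[OF h]
  have Dc: "x \<in> carrier A" if "x \<in> ?D" for x using I(1) that by auto
  have gen: "sym_bracket B u v \<in> h ` ?D" if uv: "u \<in> carrier B" "v \<in> carrier B" for u v
  proof -
    obtain x y where x: "x \<in> carrier A" "u \<ominus>\<^bsub>B\<^esub> h x \<in> lie_center B"
      and y: "y \<in> carrier A" "v \<ominus>\<^bsub>B\<^esub> h y \<in> lie_center B"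
      using surj uv by meson
    have "sym_bracket B u v = sym_bracket B (h x) (h y)"
      using uv x y hD(1) by (intro B.sym_bracket_cong) auto
    also have "\<dots> = h (sym_bracket A x y)"
      using x y by (simp add: leibniz_hom_sym_bracket)
    finally show ?thesis using x y by (auto intro!: imageI A.sym_bracket_in_lie_comm)
  qed
  have right: "\<lblot>y, h x\<rblot>\<^bsub>B\<^esub> = \<zero>\<^bsub>B\<^esub>" if "x \<in> ?D" "y \<in> carrier B" for x y
    using lie_comm_image_subset that by (auto intro!: B.bracket_lie_comm)
  \<comment> \<open>As \<open>[y, h x]\<close> is zero, \<open>[h x, y]\<close> equals the
    symmetrised bracket of \<open>h x\<close> and \<open>y\<close>, to which \<open>gen\<close>
    applies.\<close>
  have left: "\<lblot>h x, y\<rblot>\<^bsub>B\<^esub> \<in> h ` ?D" if "x \<in> ?D" "y \<in> carrier B" for x y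
    using gen[of "h x" y] right[OF that] that Dc hD(1) by simp
  have zero: "\<zero>\<^bsub>B\<^esub> \<in> h ` ?D"
    using I(2) leibniz_hom_zero by (metis image_eqI order_refl)
  show "lie_comm K B (carrier B) (carrier B) \<subseteq> h ` ?D"
  proof (rule B.lie_comm_least[OF B.leibniz_idealI gen])
    show "x \<oplus>\<^bsub>B\<^esub> y \<in> h ` ?D" if "x \<in> h ` ?D" "y \<in> h ` ?D" for x y
      using that I(3) Dc by (auto simp flip: hD(2))
    show "a \<odot>\<^bsub>B\<^esub> x \<in> h ` ?D" if "a \<in> carrier K" "x \<in> h ` ?D" for a x
      using that I(5) Dc by (auto simp flip: hD(3))
  qed (use zero left right hD(1) Dc in auto)
qed (rule lie_comm_image_subset)

lemma diff_in_kernel: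
  assumes "x \<in> carrier A" "y \<in> carrier A" "h x = h y"
  shows "x \<ominus>\<^bsub>A\<^esub> y \<in> a_kernel A B h"
  using assms leibniz_hom_eq_iff[of x y] by (simp add: a_kernel_def')

end

text \<open>Both images are the quotient of \<open>D\<close> by the same kernel. This lemma supplies
  the isomorphism \<xi> of an isoclinism, with \<open>D\<close> the Lie-commutator of a free
  algebra.\<close>

lemma leibniz_iso_of_equal_kernels:
  assumes F: "leibniz_algebra K F" and G1: "leibniz_algebra K G1" and G2: "leibniz_algebra K G2"
    and h1: "h1 \<in> leibniz_hom K F G1" and h2: "h2 \<in> leibniz_hom K F G2"
    and D: "leibniz_ideal K F D"
    and ker: "\<forall>x\<in>D. h1 x = \<zero>\<^bsub>G1\<^esub> \<longleftrightarrow> h2 x = \<zero>\<^bsub>G2\<^esub>"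
  shows "\<exists>\<xi>\<in>leibniz_iso K (G1\<lparr>carrier := h1 ` D\<rparr>) (G2\<lparr>carrier := h2 ` D\<rparr>).
    \<forall>x\<in>D. \<xi> (h1 x) = h2 x"
proof -
  interpret F: leibniz_algebra K F by (rule F)
  note I = F.leibniz_idealD[OF D] and h1D = leibniz_homD[OF h1] and h2D = leibniz_homD[OF h2]
  have Dc: "x \<in> carrier F" if "x \<in> D" for x using I(1) that by auto
  \<comment> \<open>\<open>D\<close> is closed under differences, so the kernel condition can be
    applied to the difference of \<open>x\<close> and \<open>y\<close>.\<close>
  have eq: "h1 x = h1 y \<longleftrightarrow> h2 x = h2 y" if "x \<in> D" "y \<in> D" for x y
    using bspec[OF ker, of "x \<ominus>\<^bsub>F\<^esub> y"] that Dc I(3,4)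
    by (simp add: leibniz_hom_eq_iff[OF F G1 h1] leibniz_hom_eq_iff[OF F G2 h2] F.G.M.minus_eq)
  \<comment> \<open>The preimage in \<open>D\<close> is arbitrary; by \<open>eq\<close> its value
    under \<open>h2\<close> does not depend on the choice.\<close>
  let ?\<xi> = "\<lambda>u. h2 (inv_into D h1 u)"
  have \<xi>: "?\<xi> (h1 x) = h2 x" if "x \<in> D" for x
    using eq[of "inv_into D h1 (h1 x)" x] that
    by (simp add: inv_into_into f_inv_into_f)
  have "?\<xi> (h1 x \<oplus>\<^bsub>G1\<^esub> h1 y) = h2 x \<oplus>\<^bsub>G2\<^esub> h2 y" if "x \<in> D" "y \<in> D" for x y
    using \<xi>[OF I(3)[OF that]] that Dc by (simp add: h1D h2D)
  moreover have "?\<xi> (a \<odot>\<^bsub>G1\<^esub> h1 x) = a \<odot>\<^bsub>G2\<^esub> h2 x" if "a \<in> carrier K" "x \<in> D" for a x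
    using \<xi>[OF I(5)[OF that]] that Dc by (simp add: h1D h2D)
  moreover have "?\<xi> \<lblot>h1 x, h1 y\<rblot>\<^bsub>G1\<^esub> = \<lblot>h2 x, h2 y\<rblot>\<^bsub>G2\<^esub>" if "x \<in> D" "y \<in> D" for x y
    using \<xi>[OF I(6)[of x y]] that Dc by (simp add: h1D h2D)
  moreover have "bij_betw ?\<xi> (h1 ` D) (h2 ` D)"
    unfolding bij_betw_def inj_on_def using \<xi> eq by (auto simp: image_image cong: image_cong)
  ultimately have "?\<xi> \<in> leibniz_iso K (G1\<lparr>carrier := h1 ` D\<rparr>) (G2\<lparr>carrier := h2 ` D\<rparr>)"
    using \<xi> by (auto simp: leibniz_iso_def leibniz_hom_def)
  with \<xi> show ?thesis by (intro bexI[of _ ?\<xi>] ballI)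
qed

section \<open>Stem covers seen from the standard free algebra\<close>

lemma std_HL2_map_zero_imp:
  assumes G: "leibniz_algebra K G" and Q: "leibniz_algebra K Q" and \<pi>: "\<pi> \<in> leibniz_hom K G Q"
    and zero: "\<forall>A\<in>carrier (std_HL2 K G). std_HL2_map K \<pi> Q A = \<zero>\<^bsub>std_HL2 K Q\<^esub>"
    and a: "a \<in> lie_comm K (std_free K G) (carrier (std_free K G)) (carrier (std_free K G))"
    and pa: "std_proj K G a = \<zero>\<^bsub>G\<^esub>"
  shows "std_lift K \<pi> Q a \<in> lie_comm K (std_free K Q)
    (a_kernel (std_free K Q) Q (std_proj K Q)) (carrier (std_free K Q))"
    (is "_ \<in> ?J")
proof -
  interpret G: leibniz_algebra K G by (rule G)
  interpret E: leibniz_algebra K "std_free K G" by (rule G.K.free_leibniz_algebra)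
  interpret F: leibniz_algebra K "std_free K Q" by (rule G.K.free_leibniz_algebra)
  let ?E = "std_free K G" and ?F = "std_free K Q"
  let ?R = "a_kernel ?E G (std_proj K G)"
  let ?I = "lie_comm K ?E ?R (carrier ?E)" and ?D = "lie_comm K ?E (carrier ?E) (carrier ?E)"
  have ac: "a \<in> carrier ?E" using E.lie_comm_subset[of "carrier ?E" "carrier ?E"] a by auto
  have I0: "\<zero>\<^bsub>?E\<^esub> \<in> ?I"
    by (rule E.leibniz_idealD(2)[OF E.lie_comm_ideal]) (auto simp: a_kernel_def')
  have J0: "\<zero>\<^bsub>?F\<^esub> \<in> ?J"
    by (rule F.leibniz_idealD(2)[OF F.lie_comm_ideal]) (auto simp: a_kernel_def')
  have \<psi>a: "std_lift K \<pi> Q a \<in> carrier ?F"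
    by (rule leibniz_homD(1)[OF std_lift_hom(1)[OF G Q \<pi>] ac])
  let ?A = "?I +>\<^bsub>?E\<^esub> a"
  have "?A \<in> carrier (std_HL2 K G)"
    using a ac pa
    by (auto simp: HL2_def leibniz_quot_def A_RCOSETS_def' a_r_coset_def' a_kernel_def')
  \<comment> \<open>The zero of the quotient is the ideal \<open>?J\<close> itself, and
    \<open>quot_map\<close> is a union over all representatives. As \<open>a\<close> represents
    \<open>?A\<close>, the coset of its image is contained in \<open>?J\<close>, and this coset
    contains the image.\<close>
  then have "quot_map ?F ?J (std_lift K \<pi> Q) ?A = ?J"
    using zero by (simp add: HL2_def HL2_map_def leibniz_quot_def)
  moreover have "a \<in> ?A"
    using I0 ac by (force simp: a_r_coset_def')
  moreover have "std_lift K \<pi> Q a \<in> ?J +>\<^bsub>?F\<^esub> std_lift K \<pi> Q a"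
    using J0 \<psi>a F.G.M.l_zero[OF \<psi>a] by (force simp: a_r_coset_def')
  ultimately show ?thesis by (auto simp: quot_map_def)
qed

text \<open>The kernel of \<open>h\<close> on the Lie-commutator of \<open>F\<close> is described
  without reference to \<open>G\<close>. This is what allows two covers to be compared: \<xi> comes
  from the equal kernels, and its compatibility with the commutator maps comes from the last
  clause.\<close>

lemma lie_stem_cover_lift:
  assumes cover: "lie_stem_cover K N \<chi> G \<pi> Q"
  defines "F \<equiv> std_free K Q"
  shows "\<exists>h\<in>leibniz_hom K F G.
    h ` lie_comm K F (carrier F) (carrier F) = lie_comm K G (carrier G) (carrier G) \<and>
    (\<forall>x\<in>lie_comm K F (carrier F) (carrier F).
      h x = \<zero>\<^bsub>G\<^esub> \<longleftrightarrow> x \<in> lie_comm K F (a_kernel F Q (std_proj K Q)) (carrier F)) \<and>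
    (\<forall>x\<in>carrier F. \<forall>y\<in>carrier F.
      lie_comm_map G \<pi> (std_proj K Q x) (std_proj K Q y) = h (sym_bracket F x y))"
proof -
  have G: "leibniz_algebra K G" and Q: "leibniz_algebra K Q" and \<pi>: "\<pi> \<in> leibniz_hom K G Q"
    and onto: "\<pi> ` carrier G = carrier Q" and ker: "a_kernel G Q \<pi> \<subseteq> lie_center G"
    and zero: "\<forall>A\<in>carrier (std_HL2 K G). std_HL2_map K \<pi> Q A = \<zero>\<^bsub>std_HL2 K Q\<^esub>"
    using cover by (auto simp: lie_stem_cover_def lie_stem_extension_def lie_central_extension_def
        leibniz_extension_def)
  interpret G: leibniz_algebra K G by (rule G)
  have F: "leibniz_algebra K F" unfolding F_def by (rule G.K.free_leibniz_algebra)
  interpret F: leibniz_algebra K F by (rule F)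
  let ?E = "std_free K G" and ?p = "std_proj K Q" and ?\<psi> = "std_lift K \<pi> Q"
  have E: "leibniz_algebra K ?E" by (rule G.K.free_leibniz_algebra)
  have p: "?p \<in> leibniz_hom K F Q" and p_onto: "?p ` carrier F = carrier Q"
    using std_proj_hom[OF Q] by (auto simp: F_def)
  have \<psi>: "?\<psi> \<in> leibniz_hom K ?E F" using std_lift_hom(1)[OF G Q \<pi>] by (simp add: F_def)
  let ?f = "\<lambda>q. free_letter K (inv_into (carrier G) \<pi> q)"
  have inv: "inv_into (carrier G) \<pi> q \<in> carrier G" "\<pi> (inv_into (carrier G) \<pi> q) = q"
    if "q \<in> carrier Q" for q
    using that onto by (auto intro: inv_into_into f_inv_into_f)
  have f: "?f \<in> carrier Q \<rightarrow> carrier ?E"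
    unfolding free_letter_def by (auto intro!: G.K.free_word_closed inv)
  \<comment> \<open>Freeness of \<open>F\<close> gives a section of \<open>?\<psi>\<close>: the
    generator \<open>q\<close> goes to the generator of \<open>?E\<close> belonging to a chosen
    preimage of \<open>q\<close> under \<pi>.\<close>
  define s where "s = free_lift K ?E ?f"
  have s: "s \<in> leibniz_hom K F ?E"
    and s_letter: "\<And>q. q \<in> carrier Q \<Longrightarrow> s (free_letter K q) = ?f q"
    using G.K.free_lift_hom[OF E f] by (auto simp: s_def F_def)
  have \<psi>_letter: "?\<psi> (free_letter K x) = free_letter K (\<pi> x)" if "x \<in> carrier G" for x
    unfolding std_lift_def using that leibniz_homD(1)[OF \<pi>]
    by (intro G.K.free_lift_hom(2)[OF G.K.free_leibniz_algebra])
      (auto simp: free_letter_def intro!: G.K.free_word_closed)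
  \<comment> \<open>Both sides are homomorphisms on a free algebra that agree on the
    generators.\<close>
  have \<psi>s: "?\<psi> (s x) = x" if "x \<in> carrier F" for x
    using G.K.free_hom_unique[OF F[unfolded F_def] leibniz_hom_comp[OF s \<psi>, unfolded F_def]
        leibniz_hom_id[of K F, unfolded F_def] _ that[unfolded F_def]]
    by (simp add: s_letter \<psi>_letter inv)
  define h where "h = std_proj K G \<circ> s"
  have h: "h \<in> leibniz_hom K F G"
    unfolding h_def by (rule leibniz_hom_comp[OF s std_proj_hom(1)[OF G]])
  note hD = leibniz_homD[OF h]
  have \<pi>h: "\<pi> (h x) = ?p x" if "x \<in> carrier F" for x
    using std_lift_hom(2)[OF G Q \<pi> leibniz_homD(1)[OF s that]] \<psi>s[OF that] by (simp add: h_def)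
  have central: "x \<ominus>\<^bsub>G\<^esub> y \<in> lie_center G"
    if "x \<in> carrier G" "y \<in> carrier G" "\<pi> x = \<pi> y" for x y
    using diff_in_kernel[OF G Q \<pi> that] ker by auto
  let ?D = "lie_comm K F (carrier F) (carrier F)"
  let ?J = "lie_comm K F (a_kernel F Q ?p) (carrier F)"
  show ?thesis
  proof (intro bexI[of _ h] conjI ballI)
    show "h ` ?D = lie_comm K G (carrier G) (carrier G)"
    \<comment> \<open>If \<open>x\<close> lifts \<open>\<pi> y\<close> along \<open>?p\<close>, then
      \<open>h x\<close> and \<open>y\<close> have the same image under \<pi>, so their difference
      is Lie-central.\<close>
    proof (rule lie_comm_image_eq[OF F G h])
      fix y assume y: "y \<in> carrier G"
      then have "\<pi> y \<in> ?p ` carrier F" using p_onto onto by auto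
      then obtain x where "x \<in> carrier F" "\<pi> y = ?p x" by auto
      then show "\<exists>x\<in>carrier F. y \<ominus>\<^bsub>G\<^esub> h x \<in> lie_center G"
        by (intro bexI[of _ x] central y) (simp_all add: hD(1) \<pi>h)
    qed
    \<comment> \<open>For \<open>r\<close> in the kernel of \<open>?p\<close>, the element
      \<open>h r\<close> lies in the kernel of \<pi>, hence in the Lie-center, and its symmetrised
      brackets vanish.\<close>
    have "?J \<subseteq> a_kernel F G h"
    proof (rule F.lie_comm_least[OF kernel_ideal[OF F G h]])
      fix r x assume r: "r \<in> a_kernel F Q ?p" and x: "x \<in> carrier F"
      have rc: "r \<in> carrier F" using r by (simp add: a_kernel_def')
      have "h r \<in> lie_center G"
        using r rc ker \<pi>h[OF rc] hD(1)[OF rc] by (auto simp: a_kernel_def')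
      then have "sym_bracket G (h r) (h x) = \<zero>\<^bsub>G\<^esub>"
        using G.sym_bracket_commute[OF hD(1)[OF rc] hD(1)[OF x]] hD(1)[OF x]
        by (simp add: lie_center_def)
      then show "sym_bracket F r x \<in> a_kernel F G h"
        using rc x leibniz_hom_sym_bracket[OF F G h rc x] by (simp add: a_kernel_def')
    qed
    \<comment> \<open>Here the covering condition enters: \<open>s x\<close> lies in the
      Lie-commutator of \<open>?E\<close> and projects to \<open>h x\<close>, which is zero, so it
      represents a class in the second homology of \<open>G\<close>. Its image under
      \<open>?\<psi>\<close> is \<open>x\<close>.\<close>
    moreover have "x \<in> ?J" if x: "x \<in> ?D" and hx: "h x = \<zero>\<^bsub>G\<^esub>" for x
    proof -
      have "s x \<in> lie_comm K ?E (carrier ?E) (carrier ?E)"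
        using lie_comm_image_subset[OF F E s] x by auto
      then have "?\<psi> (s x) \<in> ?J"
        using std_HL2_map_zero_imp[OF G Q \<pi> zero, of "s x"] hx by (simp add: h_def F_def)
      moreover have "x \<in> carrier F"
        using x F.lie_comm_subset[of "carrier F" "carrier F"] by auto
      ultimately show ?thesis by (simp add: \<psi>s)
    qed
    ultimately show "h x = \<zero>\<^bsub>G\<^esub> \<longleftrightarrow> x \<in> ?J" if "x \<in> ?D" for x
      using that by (auto simp: a_kernel_def')
    \<comment> \<open>The preimages picked by \<open>inv_into\<close> and the elements
      \<open>h x\<close>, \<open>h y\<close> lie over the same points of \<open>Q\<close>, so they
      differ by central elements.\<close>
    show "lie_comm_map G \<pi> (?p x) (?p y) = h (sym_bracket F x y)"
      if x: "x \<in> carrier F" and y: "y \<in> carrier F" for x y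
    proof -
      note px = leibniz_homD(1)[OF p x] and py = leibniz_homD(1)[OF p y]
      show ?thesis
        unfolding lie_comm_map_def Let_def leibniz_hom_sym_bracket[OF F G h x y]
        by (rule G.sym_bracket_cong)
          (simp_all add: inv px py hD(1) x y central \<pi>h)
    qed
  qed (rule h)
qed

theorem corollary4p5:
  fixes K :: "('k, 'm) ring_scheme"
    and Q :: "('k, 'q) leibniz"
    and S :: "('k, 's) leibniz" and \<sigma> :: "'s \<Rightarrow> 'f"
    and F :: "('k, 'f) leibniz" and \<tau> :: "'f \<Rightarrow> 'q"
    and N1 :: "('k, 'n1) leibniz" and \<chi>1 :: "'n1 \<Rightarrow> 'g1"
    and G1 :: "('k, 'g1) leibniz" and \<pi>1 :: "'g1 \<Rightarrow> 'q"
    and N2 :: "('k, 'n2) leibniz" and \<chi>2 :: "'n2 \<Rightarrow> 'g2"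
    and G2 :: "('k, 'g2) leibniz" and \<pi>2 :: "'g2 \<Rightarrow> 'q"
  assumes "field K" and "\<one>\<^bsub>K\<^esub> \<oplus>\<^bsub>K\<^esub> \<one>\<^bsub>K\<^esub> \<noteq> \<zero>\<^bsub>K\<^esub>"
    and "leibniz_algebra K Q"
    and "free_presentation K S \<sigma> F \<tau> Q"
    and "\<sigma> ` carrier S \<subseteq> lie_comm K F (carrier F) (carrier F)"
    and "lie_stem_cover K N1 \<chi>1 G1 \<pi>1 Q"
    and "lie_stem_cover K N2 \<chi>2 G2 \<pi>2 Q"
  shows "lie_isoclinic K G1 \<pi>1 Q G2 \<pi>2 Q"
proof -
  let ?F = "std_free K Q" and ?p = "std_proj K Q"
  let ?D = "lie_comm K ?F (carrier ?F) (carrier ?F)"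
  have alg: "leibniz_algebra K G1" "leibniz_algebra K G2"
    using assms(6,7) by (auto simp: lie_stem_cover_def lie_stem_extension_def
        lie_central_extension_def leibniz_extension_def)
  have F: "leibniz_algebra K ?F" by (rule field.free_leibniz_algebra[OF assms(1)])
  interpret F: leibniz_algebra K ?F by (rule F)
  obtain h1 where h1: "h1 \<in> leibniz_hom K ?F G1"
    and im1: "h1 ` ?D = lie_comm K G1 (carrier G1) (carrier G1)"
    and ker1: "\<forall>x\<in>?D.
      h1 x = \<zero>\<^bsub>G1\<^esub> \<longleftrightarrow> x \<in> lie_comm K ?F (a_kernel ?F Q ?p) (carrier ?F)"
    and C1: "\<forall>x\<in>carrier ?F. \<forall>y\<in>carrier ?F.
      lie_comm_map G1 \<pi>1 (?p x) (?p y) = h1 (sym_bracket ?F x y)"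
    using lie_stem_cover_lift[OF assms(6)] by (elim bexE conjE)
  obtain h2 where h2: "h2 \<in> leibniz_hom K ?F G2"
    and im2: "h2 ` ?D = lie_comm K G2 (carrier G2) (carrier G2)"
    and ker2: "\<forall>x\<in>?D.
      h2 x = \<zero>\<^bsub>G2\<^esub> \<longleftrightarrow> x \<in> lie_comm K ?F (a_kernel ?F Q ?p) (carrier ?F)"
    and C2: "\<forall>x\<in>carrier ?F. \<forall>y\<in>carrier ?F.
      lie_comm_map G2 \<pi>2 (?p x) (?p y) = h2 (sym_bracket ?F x y)"
    using lie_stem_cover_lift[OF assms(7)] by (elim bexE conjE)
  \<comment> \<open>Within \<open>?D\<close> both kernels are one and the same ideal, determined by
    \<open>Q\<close> alone.\<close>
  have ker: "\<forall>x\<in>?D. h1 x = \<zero>\<^bsub>G1\<^esub> \<longleftrightarrow> h2 x = \<zero>\<^bsub>G2\<^esub>"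
    using ker1 ker2 by simp
  obtain \<xi> where \<xi>: "\<xi> \<in> leibniz_iso K (G1\<lparr>carrier := h1 ` ?D\<rparr>) (G2\<lparr>carrier := h2 ` ?D\<rparr>)"
    and \<xi>h: "\<forall>x\<in>?D. \<xi> (h1 x) = h2 x"
    using leibniz_iso_of_equal_kernels[OF F alg h1 h2
        F.lie_comm_ideal[OF order_refl order_refl] ker] by (elim bexE)
  have "\<xi> (lie_comm_map G1 \<pi>1 u v) = lie_comm_map G2 \<pi>2 u v"
    if "u \<in> carrier Q" "v \<in> carrier Q" for u v
  proof -
    obtain x y where "x \<in> carrier ?F" "u = ?p x" "y \<in> carrier ?F" "v = ?p y"
      using \<open>u \<in> carrier Q\<close> \<open>v \<in> carrier Q\<close> std_proj_hom(3)[OF assms(3)] by blast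
    then show ?thesis by (simp add: C1 C2 \<xi>h F.sym_bracket_in_lie_comm)
  qed
  \<comment> \<open>Both covers lie over the same \<open>Q\<close>, so the identity serves as
    \<eta>.\<close>
  moreover have "(\<lambda>x. x) \<in> leibniz_iso K Q Q"
    by (simp add: leibniz_iso_def leibniz_hom_id bij_betw_def)
  ultimately show ?thesis
    unfolding lie_isoclinic_def
    by (intro bexI[of _ "\<lambda>x. x"] bexI[OF _ \<xi>[unfolded im1 im2]] ballI)
qed

end
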